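(* Let $f\colon(\mathbb{R}^2,0)\to(\mathbb{R}^3,0)$ be a frontal and $0$ a pure-frontal singular point of $f$ with $\kappa_t(0)\neq0$, and with principal curvatures nowhere zero. Let $j\in\{1,2\}$ and suppose that $0$ is a non-degenerate singular point of the focal surface $C_j$. Then $0$ is an at least second order $\boldsymbol{V}_j$-ridge point of $f$ if and only if $0$ is a singular point of the second kind of $C_j$.
   Context: All maps are $C^\infty$. A map germ $f\colon(\mathbb{R}^2,0)\to\mathbb{R}^3$ is a frontal if there is a smooth $\nu\colon(\mathbb{R}^2,0)\to\mathbb{S}^2$ (a unit normal vector field) with $\langle df_q(X),\nu(q)\rangle=0$ for all $q$ and $X\in T_q\mathbb{R}^2$. Put $\lambda=\det(f_u,f_v,\nu)$ and $S(f)=\{q: \operatorname{rank}df_q<2\}=\lambda^{-1}(0)$. A singular point is non-degenerate if $d\lambda\ne0$ there; then near it $S(f)$ is a regular curve $\gamma$ (the singular curve) and there is a nowhere vanishing vector field $\eta$ (null vector field) with $df(\eta)=0$ along $\gamma$. It is of the first kind (resp. second kind) if $\gamma'$ and $\eta$ are linearly independent (resp. dependent) there. A singular point of the first kind is a pure-frontal singular point if $\psi(t)=\det((f\circ\gamma)'(t),\nu(\gamma(t)),d\nu_{\gamma(t)}(\eta))$ vanishes identically along $\gamma$. Adapted coordinates: around a pure-frontal singular point there are coordinates $(u,v)$ with $S(f)=\{v=0\}$, $\partial_v$ a null vector field, and $\{f_u,f_{vv},\nu\}$ orthonormal along the $u$-axis; fix such coordinates. Then $f_v=vh$, $\nu_v=v\nu_1$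 with $h,\nu_1$ smooth. Put $\tilde E=\langle f_u,f_u\rangle$, $\tilde F=\langle f_u,h\rangle$, $\tilde G=\langle h,h\rangle$, $\tilde L=-\langle f_u,\nu_u\rangle$, $\tilde M=-\langle h,\nu_u\rangle$, $\tilde N_1=-\langle h,\nu_1\rangle$. The Gaussian and mean curvatures of $f$ extend smoothly as $K=\frac{\tilde L\tilde N_1-\tilde M^2}{\tilde E\tilde G-\tilde F^2}$, $H=\frac{\tilde E\tilde N_1-2\tilde F\tilde M+\tilde G\tilde L}{2(\tilde E\tilde G-\tilde F^2)}$, and the principal curvatures are $\kappa_1=H+\sqrt{H^2-K}$, $\kappa_2=H-\sqrt{H^2-K}$ (distinct and smooth near $0$ if $\kappa_t(0)\ne0$). The cuspidal torsion is $\kappa_t(u)=\tilde M(u,0)$. Principal vectors: $\boldsymbol{V}_j=-v(\tilde M-\kappa_j\tilde F)\partial_u+(\tilde L-\kappa_j\tilde E)\partial_v$. The point $0$ is a $\boldsymbol{V}_j$-ridge point if $\boldsymbol{V}_j\kappa_j=0$ at $0$; a $k$-th order $\boldsymbol{V}_j$-ridge point if $\boldsymbol{V}_j\kappa_j=\dots=\boldsymbol{V}_j^{k}\kappa_j=0$ and $\boldsymbol{V}_j^{k+1}\kappa_j\ne0$ at $0$ (iterated directional derivatives); at least second order means $\boldsymbol{V}_j\kappa_j=\boldsymbol{V}_j^2\kappa_j=0$ at $0$. The focal surface associated to $\kappa_j$ is $C_j=f+\rho_j\nu$, $\rho_j=1/\kappa_j$. When $\kappa_t(0)\ne0$ it is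 a frontal near $0$ with unit normal $\boldsymbol{e}_j=\boldsymbol{x}_j/|\boldsymbol{x}_j|$, where $\boldsymbol{x}_j=-(\tilde M-\kappa_j\tilde F)f_u+(\tilde L-\kappa_j\tilde E)h$; notions of non-degenerate, first kind and second kind for $C_j$ are with respect to this frontal structure. *)

theory Defs
  imports "HOL-Analysis.Analysis"
begin

type_synonym plane = "real \<times> real"
type_synonym space = "real^3"


subsection \<open>Smooth maps\<close>

primrec Ck_on :: "nat \<Rightarrow> ('a::real_normed_vector \<Rightarrow> 'b::real_normed_vector) \<Rightarrow> 'a set \<Rightarrow> bool" where
  "Ck_on 0 f U \<longleftrightarrow> continuous_on U f"
| "Ck_on (Suc k) f U \<longleftrightarrow> (\<forall>x\<in>U. f differentiable at x) \<and>
     (\<forall>w. Ck_on k (\<lambda>x. frechet_derivative f (at x) w) U)"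

text \<open>Only meant for open \<open>U\<close>.\<close>

definition smooth_on :: "('a::real_normed_vector \<Rightarrow> 'b::real_normed_vector) \<Rightarrow> 'a set \<Rightarrow> bool" where
  "smooth_on f U \<longleftrightarrow> (\<forall>k. Ck_on k f U)"

definition dir_deriv :: "(plane \<Rightarrow> plane) \<Rightarrow> (plane \<Rightarrow> 'b::real_normed_vector) \<Rightarrow> plane \<Rightarrow> 'b" where
  "dir_deriv X f q = frechet_derivative f (at q) (X q)"

abbreviation partial_u :: "(plane \<Rightarrow> 'b::real_normed_vector) \<Rightarrow> plane \<Rightarrow> 'b" where
  "partial_u \<equiv> dir_deriv (\<lambda>_. (1, 0))"

abbreviation partial_v :: "(plane \<Rightarrow> 'b::real_normed_vector) \<Rightarrow> plane \<Rightarrow> 'b" where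
  "partial_v \<equiv> dir_deriv (\<lambda>_. (0, 1))"

definition det3 :: "space \<Rightarrow> space \<Rightarrow> space \<Rightarrow> real" where
  "det3 a b c = det (vector [a, b, c] :: real^3^3)"

definition lin_indep2 :: "'a::real_vector \<Rightarrow> 'a \<Rightarrow> bool" where
  "lin_indep2 x y \<longleftrightarrow> x \<noteq> y \<and> independent {x, y}"


subsection \<open>Frontals and their singular points\<close>

text \<open>Germs are represented by total functions of which only the restriction to
  some unspecified neighbourhood of the base point matters.\<close>

definition frontal_at :: "(plane \<Rightarrow> space) \<Rightarrow> (plane \<Rightarrow> space) \<Rightarrow> plane \<Rightarrow> bool" where
  "frontal_at f \<nu> p \<longleftrightarrow> (\<exists>U. open U \<and> p \<in> U \<and> smooth_on f U \<and> smooth_on \<nu> U \<and>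
     (\<forall>q\<in>U. norm (\<nu> q) = 1 \<and> (\<forall>X. frechet_derivative f (at q) X \<bullet> \<nu> q = 0)))"

definition singular_set :: "(plane \<Rightarrow> space) \<Rightarrow> plane set" where
  "singular_set f = {q. dim (range (frechet_derivative f (at q))) < 2}"

definition lambda_fun :: "(plane \<Rightarrow> space) \<Rightarrow> (plane \<Rightarrow> space) \<Rightarrow> plane \<Rightarrow> real" where
  "lambda_fun f \<nu> q = det3 (partial_u f q) (partial_v f q) (\<nu> q)"

text \<open>In the following notions \<open>\<nu>\<close> is meant to be a unit normal vector field of the
  frontal \<open>f\<close> near \<open>p\<close>.\<close>

definition nondegenerate_singular_point ::
    "(plane \<Rightarrow> space) \<Rightarrow> (plane \<Rightarrow> space) \<Rightarrow> plane \<Rightarrow> bool" where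
  "nondegenerate_singular_point f \<nu> p \<longleftrightarrow>
     p \<in> singular_set f \<and> frechet_derivative (lambda_fun f \<nu>) (at p) \<noteq> (\<lambda>_. 0)"

definition singular_curve :: "(plane \<Rightarrow> space) \<Rightarrow> plane \<Rightarrow> real \<Rightarrow> (real \<Rightarrow> plane) \<Rightarrow> bool" where
  "singular_curve f p \<epsilon> \<gamma> \<longleftrightarrow>
     0 < \<epsilon> \<and> \<gamma> 0 = p \<and> smooth_on \<gamma> {-\<epsilon><..<\<epsilon>} \<and> inj_on \<gamma> {-\<epsilon><..<\<epsilon>} \<and>
     (\<forall>t\<in>{-\<epsilon><..<\<epsilon>}. vector_derivative \<gamma> (at t) \<noteq> 0) \<and>
     (\<exists>W. open W \<and> p \<in> W \<and> singular_set f \<inter> W = \<gamma> ` {-\<epsilon><..<\<epsilon>})"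

definition null_vector_field ::
    "(plane \<Rightarrow> space) \<Rightarrow> real \<Rightarrow> (real \<Rightarrow> plane) \<Rightarrow> (plane \<Rightarrow> plane) \<Rightarrow> bool" where
  "null_vector_field f \<epsilon> \<gamma> \<eta> \<longleftrightarrow>
     (\<exists>W. open W \<and> \<gamma> ` {-\<epsilon><..<\<epsilon>} \<subseteq> W \<and> smooth_on \<eta> W \<and> (\<forall>q\<in>W. \<eta> q \<noteq> 0)) \<and>
     (\<forall>t\<in>{-\<epsilon><..<\<epsilon>}. frechet_derivative f (at (\<gamma> t)) (\<eta> (\<gamma> t)) = 0)"

definition first_kind_singular_point ::
    "(plane \<Rightarrow> space) \<Rightarrow> (plane \<Rightarrow> space) \<Rightarrow> plane \<Rightarrow> bool" where
  "first_kind_singular_point f \<nu> p \<longleftrightarrow> nondegenerate_singular_point f \<nu> p \<and>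
     (\<exists>\<epsilon> \<gamma> \<eta>. singular_curve f p \<epsilon> \<gamma> \<and> null_vector_field f \<epsilon> \<gamma> \<eta> \<and>
        lin_indep2 (vector_derivative \<gamma> (at 0)) (\<eta> p))"

definition second_kind_singular_point ::
    "(plane \<Rightarrow> space) \<Rightarrow> (plane \<Rightarrow> space) \<Rightarrow> plane \<Rightarrow> bool" where
  "second_kind_singular_point f \<nu> p \<longleftrightarrow> nondegenerate_singular_point f \<nu> p \<and>
     (\<exists>\<epsilon> \<gamma> \<eta>. singular_curve f p \<epsilon> \<gamma> \<and> null_vector_field f \<epsilon> \<gamma> \<eta> \<and>
        \<not> lin_indep2 (vector_derivative \<gamma> (at 0)) (\<eta> p))"

definition psi_fun ::
    "(plane \<Rightarrow> space) \<Rightarrow> (plane \<Rightarrow> space) \<Rightarrow> (real \<Rightarrow> plane) \<Rightarrow> (plane \<Rightarrow> plane) \<Rightarrow> real \<Rightarrow> real" where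
  "psi_fun f \<nu> \<gamma> \<eta> t =
     det3 (vector_derivative (f \<circ> \<gamma>) (at t)) (\<nu> (\<gamma> t)) (dir_deriv \<eta> \<nu> (\<gamma> t))"

definition pure_frontal_singular_point ::
    "(plane \<Rightarrow> space) \<Rightarrow> (plane \<Rightarrow> space) \<Rightarrow> plane \<Rightarrow> bool" where
  "pure_frontal_singular_point f \<nu> p \<longleftrightarrow> first_kind_singular_point f \<nu> p \<and>
     (\<exists>\<epsilon> \<gamma> \<eta>. singular_curve f p \<epsilon> \<gamma> \<and> null_vector_field f \<epsilon> \<gamma> \<eta> \<and>
        (\<forall>t\<in>{-\<epsilon><..<\<epsilon>}. psi_fun f \<nu> \<gamma> \<eta> t = 0))"


subsection \<open>Adapted coordinates\<close>

definition orthonormal3 :: "space \<Rightarrow> space \<Rightarrow> space \<Rightarrow> bool" where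
  "orthonormal3 a b c \<longleftrightarrow> norm a = 1 \<and> norm b = 1 \<and> norm c = 1 \<and>
     a \<bullet> b = 0 \<and> b \<bullet> c = 0 \<and> a \<bullet> c = 0"

definition local_diffeo_at_0 :: "(plane \<Rightarrow> plane) \<Rightarrow> bool" where
  "local_diffeo_at_0 \<phi> \<longleftrightarrow> \<phi> 0 = 0 \<and>
     (\<exists>U V \<theta>. open U \<and> 0 \<in> U \<and> open V \<and> homeomorphism U V \<phi> \<theta> \<and>
        smooth_on \<phi> U \<and> smooth_on \<theta> V)"

text \<open>\<open>\<phi>\<close> maps the adapted coordinates \<open>(u, v)\<close> to points of the source of \<open>f\<close>, so that
  \<open>f \<circ> \<phi>\<close> and \<open>\<nu> \<circ> \<phi>\<close> are \<open>f\<close> and \<open>\<nu>\<close> written in these coordinates.\<close>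

definition adapted_coordinates ::
    "(plane \<Rightarrow> space) \<Rightarrow> (plane \<Rightarrow> space) \<Rightarrow> (plane \<Rightarrow> plane) \<Rightarrow> bool" where
  "adapted_coordinates f \<nu> \<phi> \<longleftrightarrow> local_diffeo_at_0 \<phi> \<and>
     (\<exists>U. open U \<and> 0 \<in> U \<and>
        singular_set (f \<circ> \<phi>) \<inter> U = {q \<in> U. snd q = 0} \<and>
        (\<forall>q\<in>U. snd q = 0 \<longrightarrow>
           partial_v (f \<circ> \<phi>) q = 0 \<and>
           orthonormal3 (partial_u (f \<circ> \<phi>) q) (partial_v (partial_v (f \<circ> \<phi>)) q) (\<nu> (\<phi> q))))"


subsection \<open>Invariants in adapted coordinates\<close>

text \<open>From here on \<open>f\<close> and \<open>\<nu>\<close> are already written in adapted coordinates.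

  For \<open>F\<close> smooth and vanishing on the \<open>u\<close>-axis, \<open>div_v F\<close> is the unique continuous
  (in fact smooth) function with \<open>F = v \<cdot> div_v F\<close>. So \<open>h_fun f\<close> and \<open>nu1_fun \<nu>\<close> are the
  functions \<open>h\<close> and \<open>\<nu>\<^sub>1\<close> in \<open>f\<^sub>v = v h\<close> and \<open>\<nu>\<^sub>v = v \<nu>\<^sub>1\<close>.\<close>

definition div_v :: "(plane \<Rightarrow> 'b::real_normed_vector) \<Rightarrow> plane \<Rightarrow> 'b" where
  "div_v F q = (if snd q = 0 then partial_v F q else F q /\<^sub>R snd q)"

definition h_fun :: "(plane \<Rightarrow> space) \<Rightarrow> plane \<Rightarrow> space" where
  "h_fun f = div_v (partial_v f)"

definition nu1_fun :: "(plane \<Rightarrow> space) \<Rightarrow> plane \<Rightarrow> space" where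
  "nu1_fun \<nu> = div_v (partial_v \<nu>)"

definition E_til :: "(plane \<Rightarrow> space) \<Rightarrow> plane \<Rightarrow> real" where
  "E_til f q = partial_u f q \<bullet> partial_u f q"

definition F_til :: "(plane \<Rightarrow> space) \<Rightarrow> plane \<Rightarrow> real" where
  "F_til f q = partial_u f q \<bullet> h_fun f q"

definition G_til :: "(plane \<Rightarrow> space) \<Rightarrow> plane \<Rightarrow> real" where
  "G_til f q = h_fun f q \<bullet> h_fun f q"

definition L_til :: "(plane \<Rightarrow> space) \<Rightarrow> (plane \<Rightarrow> space) \<Rightarrow> plane \<Rightarrow> real" where
  "L_til f \<nu> q = - (partial_u f q \<bullet> partial_u \<nu> q)"

definition M_til :: "(plane \<Rightarrow> space) \<Rightarrow> (plane \<Rightarrow> space) \<Rightarrow> plane \<Rightarrow> real" where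
  "M_til f \<nu> q = - (h_fun f q \<bullet> partial_u \<nu> q)"

definition N1_til :: "(plane \<Rightarrow> space) \<Rightarrow> (plane \<Rightarrow> space) \<Rightarrow> plane \<Rightarrow> real" where
  "N1_til f \<nu> q = - (h_fun f q \<bullet> nu1_fun \<nu> q)"

definition gauss_curv :: "(plane \<Rightarrow> space) \<Rightarrow> (plane \<Rightarrow> space) \<Rightarrow> plane \<Rightarrow> real" where
  "gauss_curv f \<nu> q =
     (L_til f \<nu> q * N1_til f \<nu> q - (M_til f \<nu> q)\<^sup>2) /
     (E_til f q * G_til f q - (F_til f q)\<^sup>2)"

definition mean_curv :: "(plane \<Rightarrow> space) \<Rightarrow> (plane \<Rightarrow> space) \<Rightarrow> plane \<Rightarrow> real" where
  "mean_curv f \<nu> q =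
     (E_til f q * N1_til f \<nu> q - 2 * F_til f q * M_til f \<nu> q + G_til f q * L_til f \<nu> q) /
     (2 * (E_til f q * G_til f q - (F_til f q)\<^sup>2))"

text \<open>The index \<open>j\<close> ranges over \<open>{1, 2}\<close>.\<close>

definition principal_curv :: "(plane \<Rightarrow> space) \<Rightarrow> (plane \<Rightarrow> space) \<Rightarrow> nat \<Rightarrow> plane \<Rightarrow> real" where
  "principal_curv f \<nu> j q =
     (if j = 1
      then mean_curv f \<nu> q + sqrt ((mean_curv f \<nu> q)\<^sup>2 - gauss_curv f \<nu> q)
      else mean_curv f \<nu> q - sqrt ((mean_curv f \<nu> q)\<^sup>2 - gauss_curv f \<nu> q))"

definition cuspidal_torsion :: "(plane \<Rightarrow> space) \<Rightarrow> (plane \<Rightarrow> space) \<Rightarrow> real \<Rightarrow> real" where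
  "cuspidal_torsion f \<nu> u = M_til f \<nu> (u, 0)"

definition principal_vector :: "(plane \<Rightarrow> space) \<Rightarrow> (plane \<Rightarrow> space) \<Rightarrow> nat \<Rightarrow> plane \<Rightarrow> plane" where
  "principal_vector f \<nu> j q =
     (- snd q * (M_til f \<nu> q - principal_curv f \<nu> j q * F_til f q),
      L_til f \<nu> q - principal_curv f \<nu> j q * E_til f q)"

definition ridge_at_least_second_order ::
    "(plane \<Rightarrow> space) \<Rightarrow> (plane \<Rightarrow> space) \<Rightarrow> nat \<Rightarrow> plane \<Rightarrow> bool" where
  "ridge_at_least_second_order f \<nu> j p \<longleftrightarrow>
     dir_deriv (principal_vector f \<nu> j) (principal_curv f \<nu> j) p = 0 \<and>
     (dir_deriv (principal_vector f \<nu> j) ^^ 2) (principal_curv f \<nu> j) p = 0"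

definition focal_surface :: "(plane \<Rightarrow> space) \<Rightarrow> (plane \<Rightarrow> space) \<Rightarrow> nat \<Rightarrow> plane \<Rightarrow> space" where
  "focal_surface f \<nu> j q = f q + (1 / principal_curv f \<nu> j q) *\<^sub>R \<nu> q"

definition focal_x :: "(plane \<Rightarrow> space) \<Rightarrow> (plane \<Rightarrow> space) \<Rightarrow> nat \<Rightarrow> plane \<Rightarrow> space" where
  "focal_x f \<nu> j q =
     - (M_til f \<nu> q - principal_curv f \<nu> j q * F_til f q) *\<^sub>R partial_u f q
     + (L_til f \<nu> q - principal_curv f \<nu> j q * E_til f q) *\<^sub>R h_fun f q"

definition focal_normal :: "(plane \<Rightarrow> space) \<Rightarrow> (plane \<Rightarrow> space) \<Rightarrow> nat \<Rightarrow> plane \<Rightarrow> space" where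
  "focal_normal f \<nu> j q = focal_x f \<nu> j q /\<^sub>R norm (focal_x f \<nu> j q)"

end

theory Submission
  imports Defs
begin

text \<open>
  Write \<open>\<kappa>\<close> for the principal curvature \<open>\<kappa>\<^sub>j\<close>, \<open>\<rho> = 1/\<kappa>\<close>, \<open>V\<close> for the principal vector and \<open>C = f + \<rho> \<nu>\<close>, all in
  adapted coordinates. Rodrigues' equation \<open>d\<nu>(V) = - \<kappa> df(V)\<close> holds for the extended principal vector
  (\<open>principal_direction\<close>), and therefore \<open>dC(V) = (V\<rho>) \<nu> = - (V\<kappa> / \<kappa>\<^sup>2) \<nu>\<close> (\<open>C_derivative_V\<close>). The other column
  \<open>C\<^sub>u\<close> has a part orthogonal to \<open>\<nu>\<close> that never vanishes near \<open>0\<close>. Hence, near \<open>0\<close>, the singular set of \<open>C\<close> is the zero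
  set of the function \<open>V\<kappa>\<close>, and on it the kernel of \<open>dC\<close> is spanned by \<open>V\<close> (\<open>C_kernel\<close>, \<open>singular_C_iff\<close>).

  Moreover \<open>\<lambda>\<close> of \<open>C\<close> is a smooth multiple of \<open>V\<kappa>\<close>, so at a non-degenerate singular point \<open>V\<kappa> = 0\<close> and \<open>d(V\<kappa>) \<noteq> 0\<close>
  (\<open>nondegenerate_imp_regular\<close>). The singular curve is then the regular curve \<open>V\<kappa> = 0\<close>, whose tangent is the kernel
  of \<open>d(V\<kappa>)\<close>, and the null direction is \<open>V\<close>. They are parallel at \<open>0\<close> exactly if \<open>d(V\<kappa>)(V) = V(V\<kappa>) = 0\<close> there, and this
  together with \<open>V\<kappa> = 0\<close> is the condition for a ridge point of order at least two.

  Smoothness of all orders matters because a point of the second kind must come with a smooth singular curve and a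
  smooth null vector field. The field is \<open>V\<close>; it involves \<open>h = f\<^sub>v / v\<close>, which is smooth across the axis by Hadamard's
  lemma (\<open>smooth_on_div_v\<close>). The curve comes from a smooth implicit function theorem
  (\<open>smooth_implicit_function\<close>). The pure-frontal condition enters through \<open>\<nu>\<^sub>v = 0\<close> on the axis
  (\<open>pure_frontal_axis\<close>), without which \<open>\<nu>\<^sub>1 = \<nu>\<^sub>v / v\<close> would not extend across the axis, and \<open>\<kappa>\<^sub>t \<noteq> 0\<close> keeps the two principal
  curvatures apart and \<open>V\<close> away from zero (\<open>regular_domain_exists\<close>).
\<close>

section \<open>Calculus of smooth maps\<close>

lemma Ck_on_cong:
  assumes "open U" "\<And>x. x \<in> U \<Longrightarrow> f x = g x"
  shows "Ck_on k f U \<longleftrightarrow> Ck_on k g U"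
proof -
  have "Ck_on k g U" if "Ck_on k f U" "\<And>x. x \<in> U \<Longrightarrow> f x = g x" for f g :: "'a \<Rightarrow> 'b"
    using that
  proof (induction k arbitrary: f g)
    case 0
    then show ?case using continuous_on_cong[of U U f g] by simp
  next
    case (Suc k)
    have "g differentiable at x" if "x \<in> U" for x
      using Suc.prems that assms(1) has_derivative_transform_within_open
      unfolding differentiable_def by (metis Ck_on.simps(2) differentiable_def)
    moreover have "Ck_on k (\<lambda>x. frechet_derivative g (at x) w) U" for w
    proof (rule Suc.IH)
      show "Ck_on k (\<lambda>x. frechet_derivative f (at x) w) U"
        using Suc.prems by simp
      show "frechet_derivative f (at x) w = frechet_derivative g (at x) w" if "x \<in> U" for x
        using frechet_derivative_transform_within_open[of f x U g] Suc.prems that assms(1) by simp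
    qed
    ultimately show ?case by simp
  qed
  from this[of f g] this[of g f] show ?thesis using assms(2) by auto
qed

lemma Ck_on_subset: "Ck_on k f U \<Longrightarrow> V \<subseteq> U \<Longrightarrow> Ck_on k f V"
  by (induction k arbitrary: f) (auto intro: continuous_on_subset)

lemma Ck_on_imp_continuous_on: "Ck_on k f U \<Longrightarrow> continuous_on U f"
  by (cases k) (auto intro!: continuous_at_imp_continuous_on differentiable_imp_continuous_within)

lemma Ck_on_Suc_imp_Ck_on: "Ck_on (Suc k) f U \<Longrightarrow> Ck_on k f U"
proof (induction k arbitrary: f)
  case 0
  then show ?case using Ck_on_imp_continuous_on[of "Suc 0" f U] by (simp del: Ck_on.simps(2))
next
  case (Suc k)
  then show ?case by (metis Ck_on.simps(2))
qed

text \<open>The recursive clause of \<^const>\<open>Ck_on\<close> speaks of \<^const>\<open>frechet_derivative\<close>; with this rule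
  a closure property follows by induction from the usual formula for the derivative, because that formula
  is built from functions that are already known to be \<open>k\<close> times differentiable.\<close>

lemma Ck_on_SucI:
  assumes "open U" "\<And>x. x \<in> U \<Longrightarrow> (f has_derivative f' x) (at x)"
    and "\<And>w. Ck_on k (\<lambda>x. f' x w) U"
  shows "Ck_on (Suc k) f U"
proof -
  have "frechet_derivative f (at x) = f' x" if "x \<in> U" for x
    using frechet_derivative_at[OF assms(2)[OF that]] by simp
  then have "Ck_on k (\<lambda>x. frechet_derivative f (at x) w) U" for w
    using assms(3)[of w] Ck_on_cong[OF assms(1), of "\<lambda>x. f' x w" "\<lambda>x. frechet_derivative f (at x) w"]
    by simp
  then show ?thesis using assms(2) by (auto simp: differentiable_def)
qed

lemma Ck_on_SucD:
  assumes "Ck_on (Suc k) f U" "x \<in> U"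
  shows "(f has_derivative frechet_derivative f (at x)) (at x)"
  using assms frechet_derivative_works by auto

lemma Ck_on_const: "open U \<Longrightarrow> Ck_on k (\<lambda>_. c) U"
proof (induction k arbitrary: c)
  case (Suc k)
  then show ?case by (intro Ck_on_SucI[where f' = "\<lambda>_ _. 0"]) auto
qed auto

lemma Ck_on_add:
  assumes "open U"
  shows "Ck_on k f U \<Longrightarrow> Ck_on k g U \<Longrightarrow> Ck_on k (\<lambda>x. f x + g x) U"
proof (induction k arbitrary: f g)
  case (Suc k)
  show ?case
    by (rule Ck_on_SucI[OF assms has_derivative_add[OF Ck_on_SucD[OF Suc.prems(1)] Ck_on_SucD[OF Suc.prems(2)]]])
       (use Suc in auto)
qed (auto intro: continuous_on_add)

lemma Ck_on_bounded_linear: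
  assumes "open U" "bounded_linear L"
  shows "Ck_on k f U \<Longrightarrow> Ck_on k (\<lambda>x. L (f x)) U"
proof (induction k arbitrary: f)
  case 0
  then show ?case using bounded_linear.continuous_on[OF assms(2)] by auto
next
  case (Suc k)
  show ?case
    by (rule Ck_on_SucI[OF assms(1) bounded_linear.has_derivative[OF assms(2) Ck_on_SucD[OF Suc.prems(1)]]])
       (use Suc in auto)
qed

lemma Ck_on_bounded_bilinear:
  assumes "open U" "bounded_bilinear P"
  shows "Ck_on k f U \<Longrightarrow> Ck_on k g U \<Longrightarrow> Ck_on k (\<lambda>x. P (f x) (g x)) U"
proof (induction k arbitrary: f g)
  case 0
  then show ?case using bounded_bilinear.continuous_on[OF assms(2)] by auto
next
  case (Suc k)
  have "Ck_on k f U" "Ck_on k g U" using Suc.prems Ck_on_Suc_imp_Ck_on by blast+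
  then have "Ck_on k (\<lambda>x. P (f x) (frechet_derivative g (at x) w) + P (frechet_derivative f (at x) w) (g x)) U" for w
    using Suc.prems by (intro Ck_on_add[OF assms(1)] Suc.IH) auto
  then show ?case
    by (intro Ck_on_SucI[OF assms(1) bounded_bilinear.FDERIV[OF assms(2) Ck_on_SucD[OF Suc.prems(1)] Ck_on_SucD[OF Suc.prems(2)]]])
qed

lemma Ck_on_sum:
  assumes "open U" "finite I" "\<And>i. i \<in> I \<Longrightarrow> Ck_on k (f i) U"
  shows "Ck_on k (\<lambda>x. \<Sum>i\<in>I. f i x) U"
  using assms(2,3) by (induction I) (auto intro: Ck_on_const Ck_on_add assms(1))

text \<open>In the chain rule the direction \<open>Df(x) w\<close> in which the outer function is differentiated varies with
  \<open>x\<close>, whereas \<^const>\<open>Ck_on\<close> controls derivatives in constant directions only. Expanding the varying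
  direction in a basis reduces the first kind of derivative to the second.\<close>

lemma linear_eq_sum_Basis:
  fixes z :: "'b::euclidean_space"
  assumes "linear A"
  shows "A z = (\<Sum>b\<in>Basis. (z \<bullet> b) *\<^sub>R A b)"
  by (metis (no_types, lifting) assms euclidean_representation linear_cmul linear_sum sum.cong)

lemma Ck_on_compose:
  fixes f :: "'a::real_normed_vector \<Rightarrow> 'b::euclidean_space" and g :: "'b \<Rightarrow> 'c::real_normed_vector"
  assumes "open U" 
  shows "Ck_on k f U \<Longrightarrow> Ck_on k g V \<Longrightarrow> f ` U \<subseteq> V \<Longrightarrow> Ck_on k (\<lambda>x. g (f x)) U"
proof (induction k arbitrary: g)
  case 0
  then show ?case by (auto intro: continuous_on_compose2)
next
  case (Suc k)
  have f: "Ck_on k f U" using Suc.prems Ck_on_Suc_imp_Ck_on by blast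
  have lin: "linear (frechet_derivative g (at (f x)))" if "x \<in> U" for x
    using linear_frechet_derivative Suc.prems(2,3) that by auto
  have "((\<lambda>x. g (f x)) has_derivative
      (\<lambda>w. \<Sum>b\<in>Basis. (frechet_derivative f (at x) w \<bullet> b) *\<^sub>R frechet_derivative g (at (f x)) b)) (at x)"
    if "x \<in> U" for x
  proof -
    have "f x \<in> V" using Suc.prems(3) that by auto
    from has_derivative_compose[OF Ck_on_SucD[OF Suc.prems(1) that] Ck_on_SucD[OF Suc.prems(2) this]]
    show ?thesis
      using linear_eq_sum_Basis[OF lin[OF that], of "frechet_derivative f (at x) w" for w] by simp
  qed
  moreover have "Ck_on k (\<lambda>x. \<Sum>b\<in>Basis. (frechet_derivative f (at x) w \<bullet> b) *\<^sub>R frechet_derivative g (at (f x)) b) U" for w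
  proof (intro Ck_on_sum[OF assms finite_Basis] Ck_on_bounded_bilinear[OF assms bounded_bilinear_scaleR] 
      Ck_on_bounded_linear[OF assms bounded_linear_inner_left])
    show "Ck_on k (\<lambda>x. frechet_derivative f (at x) w) U" using Suc.prems by auto
    show "Ck_on k (\<lambda>x. frechet_derivative g (at (f x)) b) U" for b
      using Suc.IH[OF f, of "\<lambda>y. frechet_derivative g (at y) b"] Suc.prems by auto
  qed
  ultimately show ?case by (rule Ck_on_SucI[OF assms])
qed

lemma Ck_on_inverse:
  fixes f :: "'a::real_normed_vector \<Rightarrow> real"
  assumes "open U" "\<And>x. x \<in> U \<Longrightarrow> f x \<noteq> 0"
  shows "Ck_on k f U \<Longrightarrow> Ck_on k (\<lambda>x. inverse (f x)) U"
proof (induction k)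
  case 0
  then show ?case using continuous_on_inverse[of U f] assms(2) by auto
next
  case (Suc k)
  have f: "Ck_on k (\<lambda>x. inverse (f x)) U" using Suc Ck_on_Suc_imp_Ck_on by blast
  have "((\<lambda>x. inverse (f x)) has_derivative
      (\<lambda>w. - (inverse (f x) * frechet_derivative f (at x) w * inverse (f x)))) (at x)" if "x \<in> U" for x
    using Deriv.has_derivative_inverse[OF assms(2)[OF that] Ck_on_SucD[OF Suc.prems(1) that]] .
  moreover have "Ck_on k (\<lambda>x. - (inverse (f x) * frechet_derivative f (at x) w * inverse (f x))) U" for w
    using Suc.prems
    by (intro Ck_on_bounded_linear[OF assms(1) bounded_linear_minus[OF bounded_linear_ident]]
        Ck_on_bounded_bilinear[OF assms(1) bounded_bilinear_mult] f) auto
  ultimately show ?case by (rule Ck_on_SucI[OF assms(1)])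
qed

lemma Ck_on_sqrt:
  fixes f :: "'a::real_normed_vector \<Rightarrow> real"
  assumes "open U" "\<And>x. x \<in> U \<Longrightarrow> f x > 0"
  shows "Ck_on k f U \<Longrightarrow> Ck_on k (\<lambda>x. sqrt (f x)) U"
proof (induction k)
  case 0
  then show ?case by (auto intro: continuous_on_real_sqrt)
next
  case (Suc k)
  have pos: "sqrt (f x) \<noteq> 0" if "x \<in> U" for x
    using assms(2)[OF that] by simp
  have "Ck_on k f U"
    using Suc.prems by (rule Ck_on_Suc_imp_Ck_on)
  then have "Ck_on k (\<lambda>x. sqrt (f x)) U"
    by (rule Suc.IH)
  with pos have f: "Ck_on k (\<lambda>x. inverse (sqrt (f x))) U"
    using Ck_on_inverse[where f = "\<lambda>x. sqrt (f x)", OF assms(1)] by simp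
  have "((\<lambda>x. sqrt (f x)) has_derivative
      (\<lambda>w. (1/2) * (frechet_derivative f (at x) w * inverse (sqrt (f x))))) (at x)"
    if "x \<in> U" for x
  proof -
    have "((\<lambda>x. sqrt (f x)) has_derivative
      (\<lambda>w. frechet_derivative f (at x) w * (inverse (sqrt (f x)) / 2))) (at x)"
      using assms(2)[OF that] Ck_on_SucD[OF Suc.prems that]
      by (auto intro!: derivative_eq_intros simp: field_simps)
    then show ?thesis by (simp add: mult.commute mult.assoc)
  qed
  moreover have "Ck_on k (\<lambda>x. (1/2) * (frechet_derivative f (at x) w * inverse (sqrt (f x)))) U" for w
    using Suc.prems
    by (intro Ck_on_bounded_bilinear[OF assms(1) bounded_bilinear_mult, of k "\<lambda>_. 1/2"]
      Ck_on_bounded_bilinear[OF assms(1) bounded_bilinear_mult] f Ck_on_const[OF assms(1)]) auto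
  ultimately show ?case by (rule Ck_on_SucI[OF assms(1)])
qed

lemma Ck_on_Pair:
  assumes "open U" "Ck_on k f U" "Ck_on k g U"
  shows "Ck_on k (\<lambda>x. (f x, g x)) U"
proof -
  have "Ck_on k (\<lambda>x. (f x, 0) + (0, g x)) U"
    using Ck_on_bounded_linear[OF assms(1) bounded_linear_Pair[OF bounded_linear_ident bounded_linear_zero] assms(2)]
      Ck_on_bounded_linear[OF assms(1) bounded_linear_Pair[OF bounded_linear_zero bounded_linear_ident] assms(3)]
    by (intro Ck_on_add[OF assms(1)])
  then show ?thesis by simp
qed

lemma smooth_on_cong:
  assumes "open U" "\<And>x. x \<in> U \<Longrightarrow> f x = g x"
  shows "smooth_on f U \<longleftrightarrow> smooth_on g U"
  unfolding smooth_on_def using Ck_on_cong[OF assms] by auto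

lemma smooth_on_subset: "smooth_on f U \<Longrightarrow> V \<subseteq> U \<Longrightarrow> smooth_on f V"
  unfolding smooth_on_def using Ck_on_subset by blast

lemma smooth_on_has_derivative:
  assumes "smooth_on f U" "x \<in> U"
  shows "(f has_derivative frechet_derivative f (at x)) (at x)"
  using assms Ck_on_SucD unfolding smooth_on_def by blast

lemma smooth_on_differentiable: "smooth_on f U \<Longrightarrow> x \<in> U \<Longrightarrow> f differentiable at x"
  using smooth_on_has_derivative differentiable_def by blast

lemma smooth_on_frechet_derivative:
  "smooth_on f U \<Longrightarrow> smooth_on (\<lambda>x. frechet_derivative f (at x) w) U"
  unfolding smooth_on_def by (metis Ck_on.simps(2))

lemma smooth_on_continuous_on: "smooth_on f U \<Longrightarrow> continuous_on U f"
  unfolding smooth_on_def using Ck_on_imp_continuous_on by blast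

lemma smooth_on_isCont: "smooth_on f U \<Longrightarrow> x \<in> U \<Longrightarrow> isCont f x"
  using smooth_on_has_derivative has_derivative_continuous by blast

lemma smooth_on_const: "open U \<Longrightarrow> smooth_on (\<lambda>_. c) U"
  unfolding smooth_on_def using Ck_on_const by blast

lemma smooth_on_add:
  "open U \<Longrightarrow> smooth_on f U \<Longrightarrow> smooth_on g U \<Longrightarrow> smooth_on (\<lambda>x. f x + g x) U"
  unfolding smooth_on_def using Ck_on_add by blast

lemma smooth_on_bounded_linear:
  "open U \<Longrightarrow> bounded_linear L \<Longrightarrow> smooth_on f U \<Longrightarrow> smooth_on (\<lambda>x. L (f x)) U"
  unfolding smooth_on_def using Ck_on_bounded_linear by blast

lemma smooth_on_bounded_bilinear:
  "open U \<Longrightarrow> bounded_bilinear P \<Longrightarrow> smooth_on f U \<Longrightarrow> smooth_on g U \<Longrightarrow>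
    smooth_on (\<lambda>x. P (f x) (g x)) U"
  unfolding smooth_on_def using Ck_on_bounded_bilinear by blast

lemma smooth_on_ident: "open U \<Longrightarrow> smooth_on (\<lambda>x. x) U"
proof -
  assume U: "open U"
  have "Ck_on k (\<lambda>x. x) U" for k
    by (cases k) (auto intro!: Ck_on_SucI[OF U, where f' = "\<lambda>_ w. w"] Ck_on_const[OF U] simp del: Ck_on.simps(2))
  then show ?thesis by (auto simp: smooth_on_def)
qed

lemma smooth_on_compose:
  fixes f :: "'a::real_normed_vector \<Rightarrow> 'b::euclidean_space"
  shows "open U \<Longrightarrow> smooth_on f U \<Longrightarrow> smooth_on g V \<Longrightarrow> f ` U \<subseteq> V \<Longrightarrow> smooth_on (\<lambda>x. g (f x)) U"
  unfolding smooth_on_def using Ck_on_compose by blast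

lemma smooth_on_inverse:
  fixes f :: "'a::real_normed_vector \<Rightarrow> real"
  shows "open U \<Longrightarrow> smooth_on f U \<Longrightarrow> (\<And>x. x \<in> U \<Longrightarrow> f x \<noteq> 0) \<Longrightarrow> smooth_on (\<lambda>x. inverse (f x)) U"
  unfolding smooth_on_def using Ck_on_inverse by blast

lemma smooth_on_sqrt:
  fixes f :: "'a::real_normed_vector \<Rightarrow> real"
  shows "open U \<Longrightarrow> smooth_on f U \<Longrightarrow> (\<And>x. x \<in> U \<Longrightarrow> f x > 0) \<Longrightarrow> smooth_on (\<lambda>x. sqrt (f x)) U"
  unfolding smooth_on_def using Ck_on_sqrt by blast

lemma smooth_on_minus: "open U \<Longrightarrow> smooth_on f U \<Longrightarrow> smooth_on (\<lambda>x. - f x) U"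
  using smooth_on_bounded_linear[OF _ bounded_linear_minus[OF bounded_linear_ident]] .

lemma smooth_on_diff:
  "open U \<Longrightarrow> smooth_on f U \<Longrightarrow> smooth_on g U \<Longrightarrow> smooth_on (\<lambda>x. f x - g x) U"
  using smooth_on_add[of U f "\<lambda>x. - g x"] smooth_on_minus[of U g] by simp

lemma smooth_on_divide:
  fixes f g :: "'a::real_normed_vector \<Rightarrow> real"
  shows "open U \<Longrightarrow> smooth_on f U \<Longrightarrow> smooth_on g U \<Longrightarrow> (\<And>x. x \<in> U \<Longrightarrow> g x \<noteq> 0) \<Longrightarrow>
    smooth_on (\<lambda>x. f x / g x) U"
  unfolding divide_inverse by (intro smooth_on_bounded_bilinear[OF _ bounded_bilinear_mult] smooth_on_inverse)

lemma smooth_on_power2: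
  fixes f :: "'a::real_normed_vector \<Rightarrow> real"
  shows "open U \<Longrightarrow> smooth_on f U \<Longrightarrow> smooth_on (\<lambda>x. (f x)\<^sup>2) U"
  unfolding power2_eq_square by (intro smooth_on_bounded_bilinear[OF _ bounded_bilinear_mult])

lemma smooth_on_Pair:
  "open U \<Longrightarrow> smooth_on f U \<Longrightarrow> smooth_on g U \<Longrightarrow> smooth_on (\<lambda>x. (f x, g x)) U"
  unfolding smooth_on_def using Ck_on_Pair by blast

lemma linear_plane_decomp:
  fixes A :: "plane \<Rightarrow> 'b::real_vector"
  assumes "linear A"
  shows "A w = fst w *\<^sub>R A (1, 0) + snd w *\<^sub>R A (0, 1)"
proof -
  have "w = fst w *\<^sub>R (1, 0) + snd w *\<^sub>R (0, 1)" by (simp add: prod_eq_iff)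
  then have "A w = A (fst w *\<^sub>R (1, 0) + snd w *\<^sub>R (0, 1))" by simp
  then show ?thesis by (simp only: linear_add[OF assms] linear_cmul[OF assms])
qed

lemma smooth_on_dir_deriv:
  assumes "open U" "smooth_on f U" "smooth_on X U"
  shows "smooth_on (dir_deriv X f) U"
proof -
  have "smooth_on (\<lambda>q. fst (X q) *\<^sub>R frechet_derivative f (at q) (1, 0) + snd (X q) *\<^sub>R frechet_derivative f (at q) (0, 1)) U"
    using assms
    by (intro smooth_on_add smooth_on_bounded_bilinear[OF _ bounded_bilinear_scaleR] 
      smooth_on_frechet_derivative smooth_on_bounded_linear[OF _ bounded_linear_fst] smooth_on_bounded_linear[OF _ bounded_linear_snd])
  moreover have "fst (X q) *\<^sub>R frechet_derivative f (at q) (1, 0) + snd (X q) *\<^sub>R frechet_derivative f (at q) (0, 1)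
      = dir_deriv X f q" if "q \<in> U" for q
  proof -
    have l: "linear (frechet_derivative f (at q))"
      using linear_frechet_derivative smooth_on_differentiable[OF assms(2) that] by blast
    show ?thesis
      unfolding dir_deriv_def using linear_plane_decomp[OF l, of "X q"] by simp
  qed
  ultimately show ?thesis
    using smooth_on_cong[OF assms(1), of "\<lambda>q. fst (X q) *\<^sub>R frechet_derivative f (at q) (1, 0)
      + snd (X q) *\<^sub>R frechet_derivative f (at q) (0, 1)" "dir_deriv X f"] by simp
qed

lemmas smooth_on_inner = smooth_on_bounded_bilinear[OF _ bounded_bilinear_inner]
lemmas smooth_on_mult = smooth_on_bounded_bilinear[OF _ bounded_bilinear_mult]
lemmas smooth_on_scaleR = smooth_on_bounded_bilinear[OF _ bounded_bilinear_scaleR]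
lemmas smooth_on_fst = smooth_on_bounded_linear[OF _ bounded_linear_fst]
lemmas smooth_on_snd = smooth_on_bounded_linear[OF _ bounded_linear_snd]

lemmas smooth_on_intros = smooth_on_const smooth_on_ident smooth_on_add smooth_on_diff smooth_on_minus
  smooth_on_inner smooth_on_mult smooth_on_scaleR smooth_on_fst smooth_on_snd smooth_on_Pair
  smooth_on_divide smooth_on_power2 smooth_on_sqrt smooth_on_dir_deriv


section \<open>Symmetry of second derivatives, implicit functions, division by a coordinate\<close>

lemma has_real_derivative_along_path:
  fixes g :: "'a::real_normed_vector \<Rightarrow> real"
  assumes "(g has_derivative g') (at (p t))" "(p has_derivative (\<lambda>h. h *\<^sub>R a)) (at t)"
  shows "((\<lambda>x. g (p x)) has_real_derivative g' a) (at t)"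
proof -
  have "(\<lambda>h. g' (h *\<^sub>R a)) = (*) (g' a)"
    using linear_cmul[OF has_derivative_linear[OF assms(1)]] by (auto simp: fun_eq_iff)
  then show ?thesis
    using has_derivative_compose[OF assms(2,1)] unfolding has_field_derivative_def by simp
qed

text \<open>The mean value theorem, applied once in each direction, writes the second difference quotient as an
  iterated derivative at an intermediate point. The left-hand side is symmetric in \<open>a\<close> and \<open>b\<close>, and that
  forces the symmetry of second derivatives in the limit \<open>s \<rightarrow> 0\<close>.\<close>

lemma second_difference_eq:
  fixes f :: "'a::real_normed_vector \<Rightarrow> real"
  assumes "smooth_on f U" "0 < s"
    and in_U: "\<And>x y. 0 \<le> x \<Longrightarrow> x \<le> s \<Longrightarrow> 0 \<le> y \<Longrightarrow> y \<le> s \<Longrightarrow> q + x *\<^sub>R a + y *\<^sub>R b \<in> U"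
  obtains x y where "0 < x" "x < s" "0 < y" "y < s"
    "f (q + s *\<^sub>R a + s *\<^sub>R b) - f (q + s *\<^sub>R a) - f (q + s *\<^sub>R b) + f q
      = s\<^sup>2 * frechet_derivative (\<lambda>z. frechet_derivative f (at z) a) (at (q + x *\<^sub>R a + y *\<^sub>R b)) b"
proof -
  let ?fa = "\<lambda>z. frechet_derivative f (at z) a"
  have along_a: "((\<lambda>x. g (q + x *\<^sub>R a + y *\<^sub>R b)) has_real_derivative
      frechet_derivative g (at (q + x *\<^sub>R a + y *\<^sub>R b)) a) (at x)"
    if "smooth_on g U" "0 \<le> x" "x \<le> s" "0 \<le> y" "y \<le> s" for g :: "'a \<Rightarrow> real" and x y
  proof -
    have d: "(g has_derivative frechet_derivative g (at (q + x *\<^sub>R a + y *\<^sub>R b))) (at (q + x *\<^sub>R a + y *\<^sub>R b))"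
      by (rule smooth_on_has_derivative[OF that(1) in_U[OF that(2-)]])
    have i: "((\<lambda>x. q + x *\<^sub>R a + y *\<^sub>R b) has_derivative (\<lambda>h. h *\<^sub>R a)) (at x)"
      by (auto intro!: derivative_eq_intros)
    show ?thesis
      by (rule has_real_derivative_along_path[OF d i])
  qed
  have along_b: "((\<lambda>y. g (q + x *\<^sub>R a + y *\<^sub>R b)) has_real_derivative
      frechet_derivative g (at (q + x *\<^sub>R a + y *\<^sub>R b)) b) (at y)"
    if "smooth_on g U" "0 \<le> x" "x \<le> s" "0 \<le> y" "y \<le> s" for g :: "'a \<Rightarrow> real" and x y
  proof -
    have d: "(g has_derivative frechet_derivative g (at (q + x *\<^sub>R a + y *\<^sub>R b))) (at (q + x *\<^sub>R a + y *\<^sub>R b))"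
      by (rule smooth_on_has_derivative[OF that(1) in_U[OF that(2-)]])
    have i: "((\<lambda>y. q + x *\<^sub>R a + y *\<^sub>R b) has_derivative (\<lambda>h. h *\<^sub>R b)) (at y)"
      by (auto intro!: derivative_eq_intros)
    show ?thesis
      by (rule has_real_derivative_along_path[OF d i])
  qed
  obtain x where x: "0 < x" "x < s"
    and eq1: "(f (q + s *\<^sub>R a + s *\<^sub>R b) - f (q + s *\<^sub>R a + 0 *\<^sub>R b))
      - (f (q + 0 *\<^sub>R a + s *\<^sub>R b) - f (q + 0 *\<^sub>R a + 0 *\<^sub>R b))
      = (s - 0) * (?fa (q + x *\<^sub>R a + s *\<^sub>R b) - ?fa (q + x *\<^sub>R a + 0 *\<^sub>R b))"
    using MVT2[OF assms(2), of "\<lambda>x. f (q + x *\<^sub>R a + s *\<^sub>R b) - f (q + x *\<^sub>R a + 0 *\<^sub>R b)"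
        "\<lambda>x. ?fa (q + x *\<^sub>R a + s *\<^sub>R b) - ?fa (q + x *\<^sub>R a + 0 *\<^sub>R b)"]
      DERIV_diff[OF along_a[OF assms(1), of _ s] along_a[OF assms(1), of _ 0]] assms(2) by auto
  obtain y where y: "0 < y" "y < s"
    and eq2: "?fa (q + x *\<^sub>R a + s *\<^sub>R b) - ?fa (q + x *\<^sub>R a + 0 *\<^sub>R b)
      = (s - 0) * frechet_derivative ?fa (at (q + x *\<^sub>R a + y *\<^sub>R b)) b"
    using MVT2[OF assms(2), of "\<lambda>y. ?fa (q + x *\<^sub>R a + y *\<^sub>R b)"
        "\<lambda>y. frechet_derivative ?fa (at (q + x *\<^sub>R a + y *\<^sub>R b)) b"]
      along_b[OF smooth_on_frechet_derivative[OF assms(1)], of x _ a] x by auto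
  show ?thesis
    using that[OF x y] eq1 eq2 by (simp add: power2_eq_square)
qed

lemma symmetric_second_derivative_real:
  fixes f :: "'a::real_normed_vector \<Rightarrow> real"
  assumes "open U" "smooth_on f U" "q \<in> U"
  shows "frechet_derivative (\<lambda>z. frechet_derivative f (at z) a) (at q) b
       = frechet_derivative (\<lambda>z. frechet_derivative f (at z) b) (at q) a" (is "?A q = ?B q")
proof (rule ccontr)
  assume neq: "?A q \<noteq> ?B q"
  define e where "e = \<bar>?A q - ?B q\<bar> / 2"
  have "e > 0" using neq by (simp add: e_def)
  have smA: "smooth_on ?A U" and smB: "smooth_on ?B U"
    by (intro smooth_on_frechet_derivative assms(2))+
  have "\<forall>\<^sub>F z in nhds q. dist (?A z) (?A q) < e" "\<forall>\<^sub>F z in nhds q. dist (?B z) (?B q) < e"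
    using smooth_on_isCont[OF smA assms(3)] smooth_on_isCont[OF smB assms(3)] \<open>e > 0\<close>
    unfolding continuous_at_eps_delta eventually_nhds_metric by blast+
  moreover have "\<forall>\<^sub>F z in nhds q. z \<in> U"
    using assms(1,3) by (simp add: eventually_nhds_in_open)
  ultimately have "\<forall>\<^sub>F z in nhds q. z \<in> U \<and> dist (?A z) (?A q) < e \<and> dist (?B z) (?B q) < e"
    by eventually_elim auto
  then obtain r where "r > 0"
    and r: "\<And>z. dist z q < r \<Longrightarrow> z \<in> U \<and> dist (?A z) (?A q) < e \<and> dist (?B z) (?B q) < e"
    unfolding eventually_nhds_metric by blast
  define s where "s = r / (norm a + norm b + 1)"
  have "norm a + norm b + 1 > 0" by (simp add: add_nonneg_pos)
  then have "s > 0" using \<open>r > 0\<close> by (simp add: s_def)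
  have near: "dist (q + x *\<^sub>R a + y *\<^sub>R b) q < r" if "0 \<le> x" "x \<le> s" "0 \<le> y" "y \<le> s" for x y
  proof -
    have "dist (q + x *\<^sub>R a + y *\<^sub>R b) q = norm (x *\<^sub>R a + y *\<^sub>R b)" by (simp add: dist_norm)
    also have "\<dots> \<le> x * norm a + y * norm b"
      using norm_triangle_ineq[of "x *\<^sub>R a" "y *\<^sub>R b"] that by simp
    also have "\<dots> \<le> s * norm a + s * norm b"
      using that by (intro add_mono mult_right_mono) auto
    also have "\<dots> < s * (norm a + norm b + 1)" using \<open>s > 0\<close> by (simp add: algebra_simps)
    also have "\<dots> = r" using \<open>norm a + norm b + 1 > 0\<close> by (simp add: s_def)
    finally show ?thesis .
  qed
  have in_U: "q + x *\<^sub>R a + y *\<^sub>R b \<in> U" "q + x *\<^sub>R b + y *\<^sub>R a \<in> U"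
    if "0 \<le> x" "x \<le> s" "0 \<le> y" "y \<le> s" for x y
    using r[OF near[OF that]] r[OF near[OF that(3,4,1,2)]]
    by (simp_all add: add.assoc add.commute[of "x *\<^sub>R b"])
  obtain x y where xy: "0 < x" "x < s" "0 < y" "y < s"
    "f (q + s *\<^sub>R a + s *\<^sub>R b) - f (q + s *\<^sub>R a) - f (q + s *\<^sub>R b) + f q
      = s\<^sup>2 * ?A (q + x *\<^sub>R a + y *\<^sub>R b)"
    using second_difference_eq[OF assms(2) \<open>s > 0\<close>, OF in_U(1)] .
  obtain x' y' where xy': "0 < x'" "x' < s" "0 < y'" "y' < s"
    "f (q + s *\<^sub>R b + s *\<^sub>R a) - f (q + s *\<^sub>R b) - f (q + s *\<^sub>R a) + f q
      = s\<^sup>2 * ?B (q + x' *\<^sub>R b + y' *\<^sub>R a)"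
    using second_difference_eq[OF assms(2) \<open>s > 0\<close>, OF in_U(2)] .
  have "q + s *\<^sub>R b + s *\<^sub>R a = q + s *\<^sub>R a + s *\<^sub>R b" by simp
  then have "f (q + s *\<^sub>R b + s *\<^sub>R a) = f (q + s *\<^sub>R a + s *\<^sub>R b)" by (rule arg_cong)
  then have "s\<^sup>2 * ?A (q + x *\<^sub>R a + y *\<^sub>R b) = s\<^sup>2 * ?B (q + x' *\<^sub>R b + y' *\<^sub>R a)"
    using xy(5) xy'(5) by linarith
  then have "?A (q + x *\<^sub>R a + y *\<^sub>R b) = ?B (q + y' *\<^sub>R a + x' *\<^sub>R b)"
    using \<open>s > 0\<close> by (simp add: add.assoc add.commute[of "x' *\<^sub>R b"])
  moreover have "dist (?A (q + x *\<^sub>R a + y *\<^sub>R b)) (?A q) < e"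
    "dist (?B (q + y' *\<^sub>R a + x' *\<^sub>R b)) (?B q) < e"
    using r[OF near[of x y]] r[OF near[of y' x']] xy xy' by simp_all
  ultimately show False unfolding e_def dist_real_def by (auto simp: field_simps abs_if split: if_splits)
qed

lemma frechet_derivative_inner_left:
  assumes "f differentiable at q"
  shows "frechet_derivative (\<lambda>z. f z \<bullet> c) (at q) w = frechet_derivative f (at q) w \<bullet> c"
  using frechet_derivative_at[OF has_derivative_inner_left[OF assms[unfolded frechet_derivative_works]]] 
  by metis

lemma symmetric_second_derivative:
  fixes f :: "'a::real_normed_vector \<Rightarrow> 'b::euclidean_space"
  assumes "open U" "smooth_on f U" "q \<in> U"
  shows "frechet_derivative (\<lambda>z. frechet_derivative f (at z) a) (at q) b
       = frechet_derivative (\<lambda>z. frechet_derivative f (at z) b) (at q) a"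
proof (rule euclidean_eqI)
  fix c :: 'b
  have twice: "frechet_derivative (\<lambda>z. frechet_derivative (\<lambda>z. f z \<bullet> c) (at z) a) (at q) b
      = frechet_derivative (\<lambda>z. frechet_derivative f (at z) a) (at q) b \<bullet> c" for a b
  proof -
    have "frechet_derivative (\<lambda>z. frechet_derivative (\<lambda>z. f z \<bullet> c) (at z) a) (at q)
        = frechet_derivative (\<lambda>z. frechet_derivative f (at z) a \<bullet> c) (at q)"
    proof (rule frechet_derivative_transform_within_open[OF _ assms(1,3)])
      show "(\<lambda>z. frechet_derivative (\<lambda>z. f z \<bullet> c) (at z) a) differentiable at q"
        by (intro smooth_on_differentiable[OF _ assms(3)] smooth_on_frechet_derivative
            smooth_on_inner smooth_on_const assms(1,2))
    qed (simp add: frechet_derivative_inner_left smooth_on_differentiable[OF assms(2)])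
    then show ?thesis
      using frechet_derivative_inner_left smooth_on_differentiable[OF smooth_on_frechet_derivative[OF assms(2)] assms(3)]
      by metis
  qed
  show "frechet_derivative (\<lambda>z. frechet_derivative f (at z) a) (at q) b \<bullet> c
      = frechet_derivative (\<lambda>z. frechet_derivative f (at z) b) (at q) a \<bullet> c"
    using symmetric_second_derivative_real[OF assms(1)
        smooth_on_inner[OF assms(1,2) smooth_on_const[OF assms(1), of c]] assms(3), of a b]
    by (simp only: twice)
qed

text \<open>The zero set of a smooth function with \<open>F\<^sub>u \<noteq> 0\<close> is locally the graph of a smooth function \<open>u = c(v)\<close>.
  The inverse function theorem for \<open>(F, v)\<close> makes \<open>c\<close> differentiable. Smoothness then comes for free: \<open>c\<close> solves
  \<open>c'(t) = G(c(t), t)\<close> with the smooth function \<open>G = - F\<^sub>v / F\<^sub>u\<close>, so each order of differentiability of \<open>c\<close>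
  passes to \<open>c'\<close>.\<close>

lemma smooth_implicit_function:
  fixes F :: "plane \<Rightarrow> real"
  assumes "open U" "smooth_on F U" "0 \<in> U" "F 0 = 0" "partial_u F 0 \<noteq> 0"
  obtains \<epsilon> W c where "0 < \<epsilon>" "open W" "0 \<in> W" "W \<subseteq> U" "smooth_on c {-\<epsilon><..<\<epsilon>}" "c 0 = 0"
    "(c has_real_derivative - partial_v F 0 / partial_u F 0) (at 0)"
    "{q \<in> W. F q = 0} = (\<lambda>t. (c t, t)) ` {-\<epsilon><..<\<epsilon>}"
proof -
  let ?D = "\<lambda>q. frechet_derivative F (at q)"
  have sm_u: "smooth_on (partial_u F) U" and sm_v: "smooth_on (partial_v F) U"
    using assms(1,2) by (intro smooth_on_intros; simp)+
  define U0 where "U0 = {q \<in> U. partial_u F q \<noteq> 0}"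
  have U0: "open U0" "0 \<in> U0" "U0 \<subseteq> U"
    using assms continuous_open_preimage[OF smooth_on_continuous_on[OF sm_u] assms(1), of "- {0}"]
    by (auto simp: U0_def vimage_def Int_def open_Compl)
  have DF: "(F has_derivative ?D q) (at q)" if "q \<in> U0" for q
    using smooth_on_has_derivative[OF assms(2)] U0(3) that by blast
  have split: "?D q w = fst w * partial_u F q + snd w * partial_v F q" if "q \<in> U0" for q w
    using linear_plane_decomp[OF has_derivative_linear[OF DF[OF that]], of w] by (simp add: dir_deriv_def)
  define \<Psi> where "\<Psi> q = (F q, snd q)" for q :: plane
  define \<Psi>' where "\<Psi>' q = Blinfun (\<lambda>w. (?D q w, snd w))" for q
  have bl: "bounded_linear (\<lambda>w. (?D q w, snd w))" if "q \<in> U0" for q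
    using has_derivative_bounded_linear[OF DF[OF that]] bounded_linear_snd
    by (rule bounded_linear_Pair)
  have app: "blinfun_apply (\<Psi>' q) w = (?D q w, snd w)" if "q \<in> U0" for q w
    unfolding \<Psi>'_def by (simp add: bounded_linear_Blinfun_apply[OF bl[OF that]])
  have der: "(\<Psi> has_derivative blinfun_apply (\<Psi>' q)) (at q)" if "q \<in> U0" for q
    unfolding \<Psi>_def \<Psi>'_def bounded_linear_Blinfun_apply[OF bl[OF that]]
    by (intro has_derivative_Pair DF[OF that]) (auto intro!: derivative_eq_intros)
  have cont: "continuous_on U0 \<Psi>'"
  proof (rule continuous_on_blinfun_componentwise)
    fix b :: plane
    have "continuous_on U0 (\<lambda>q. (?D q b, snd b))"
      using smooth_on_continuous_on[OF smooth_on_frechet_derivative[OF assms(2), of b]] U0(3)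
      by (intro continuous_intros) (auto intro: continuous_on_subset)
    then show "continuous_on U0 (\<lambda>q. blinfun_apply (\<Psi>' q) b)"
      by (rule continuous_on_eq) (simp add: app)
  qed
  define I where "I = Blinfun (\<lambda>w :: plane. ((fst w - snd w * partial_v F 0) / partial_u F 0, snd w))"
  have "bounded_linear (\<lambda>w :: plane. ((fst w - snd w * partial_v F 0) / partial_u F 0, snd w))"
    by (intro bounded_linear_Pair bounded_linear_divide[THEN bounded_linear_compose]
        bounded_linear_sub bounded_linear_fst bounded_linear_snd
        bounded_linear_mult_left[THEN bounded_linear_compose])
  then have I: "blinfun_apply I w = ((fst w - snd w * partial_v F 0) / partial_u F 0, snd w)" for w
    unfolding I_def by (simp add: bounded_linear_Blinfun_apply)
  have inv: "I o\<^sub>L \<Psi>' 0 = id_blinfun"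
    using assms(5) by (intro blinfun_eqI) (simp add: I app[OF U0(2)] split[OF U0(2)])
  obtain U' V \<theta> \<theta>' where U': "open U'" "U' \<subseteq> U0" "0 \<in> U'" and V: "open V" "\<Psi> 0 \<in> V"
    and hom: "homeomorphism U' V \<Psi> \<theta>" and der\<theta>: "\<And>y. y \<in> V \<Longrightarrow> (\<theta> has_derivative \<theta>' y) (at y)"
    using inverse_function_theorem[OF U0(1) der cont U0(2) inv] by metis
  have "0 \<in> V" using V(2) assms(4) by (simp add: \<Psi>_def zero_prod_def)
  then obtain \<epsilon> where "\<epsilon> > 0" and \<epsilon>: "ball 0 \<epsilon> \<subseteq> V"
    using V(1) open_contains_ball by blast
  define J where "J = {-\<epsilon><..<\<epsilon>}"
  define W where "W = U' \<inter> {q. snd q \<in> J}"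
  define c where "c t = fst (\<theta> (0, t))" for t
  have J: "open J" "0 \<in> J" using \<open>\<epsilon> > 0\<close> by (simp_all add: J_def)
  have inV: "(0, t) \<in> V" if "t \<in> J" for t
    using that \<epsilon> by (auto simp: J_def dist_norm norm_Pair intro!: subsetD[OF \<epsilon>])
  have \<theta>: "\<theta> (0, t) = (c t, t)" "(c t, t) \<in> U'" "F (c t, t) = 0" if "t \<in> J" for t
  proof -
    have "\<Psi> (\<theta> (0, t)) = (0, t)" "\<theta> (0, t) \<in> U'"
      using hom inV[OF that] unfolding homeomorphism_def by auto
    then show "\<theta> (0, t) = (c t, t)" "(c t, t) \<in> U'" "F (c t, t) = 0"
      unfolding \<Psi>_def c_def by (auto simp: prod_eq_iff) (metis prod.collapse)+
  qed
  have c_deriv: "(c has_derivative (\<lambda>s. s * (- partial_v F (c t, t) / partial_u F (c t, t)))) (at t)"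
    if t: "t \<in> J" for t
  proof -
    have "((\<lambda>t. (0 :: real, t)) has_derivative (\<lambda>s. (0, s))) (at t)"
      by (auto intro!: derivative_eq_intros)
    from has_derivative_fst[OF has_derivative_compose[OF this der\<theta>[OF inV[OF t]]]]
    obtain c' where c': "(c has_derivative c') (at t)" unfolding c_def by blast
    have q: "(c t, t) \<in> U0" using \<theta>(2)[OF t] U'(2) by blast
    have "((\<lambda>t. F (c t, t)) has_derivative (\<lambda>s. ?D (c t, t) (c' s, s))) (at t)"
      by (rule has_derivative_compose[OF has_derivative_Pair[OF c' has_derivative_ident] DF[OF q]])
    moreover have "((\<lambda>t. F (c t, t)) has_derivative (\<lambda>_. 0)) (at t)"
      by (rule has_derivative_transform_within_open[OF has_derivative_const[of "0::real"] J(1) t]) (simp add: \<theta>(3))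
    ultimately have "(\<lambda>s. ?D (c t, t) (c' s, s)) = (\<lambda>_. 0)" by (rule has_derivative_unique)
    then have "c' s * partial_u F (c t, t) + s * partial_v F (c t, t) = 0" for s
      using split[OF q, of "(c' s, s)"] by (metis fst_conv snd_conv)
    then have "c' s = s * (- partial_v F (c t, t) / partial_u F (c t, t))" for s
      using q by (simp add: U0_def field_simps eq_neg_iff_add_eq_0)
    then have "c' = (\<lambda>s. s * (- partial_v F (c t, t) / partial_u F (c t, t)))" by blast
    with c' show ?thesis by simp
  qed
  have smG: "smooth_on (\<lambda>q. - partial_v F q / partial_u F q) U0"
    using U0(1) sm_u sm_v U0(3)
    by (intro smooth_on_divide smooth_on_minus) (auto intro: smooth_on_subset simp: U0_def)
  have "Ck_on k c J" for k
  proof (induction k)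
    case 0
    show ?case
      using c_deriv by (auto intro!: continuous_at_imp_continuous_on has_derivative_continuous)
  next
    case (Suc k)
    have "Ck_on k (\<lambda>t. (c t, t)) J"
      using smooth_on_ident[OF J(1)] by (intro Ck_on_Pair[OF J(1) Suc]) (simp add: smooth_on_def)
    then have G: "Ck_on k (\<lambda>t. - partial_v F (c t, t) / partial_u F (c t, t)) J"
      using Ck_on_compose[OF J(1), of k "\<lambda>t. (c t, t)" "\<lambda>q. - partial_v F q / partial_u F q" U0]
        smG \<theta>(2) U'(2) by (auto simp: smooth_on_def)
    have "Ck_on k (\<lambda>t. s * (- partial_v F (c t, t) / partial_u F (c t, t))) J" for s
      by (rule Ck_on_bounded_linear[OF J(1) bounded_linear_mult_right G])
    with c_deriv show ?case by (rule Ck_on_SucI[OF J(1)])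
  qed
  then have "smooth_on c J" by (simp add: smooth_on_def)
  have "\<theta> (\<Psi> 0) = 0" using hom U'(3) unfolding homeomorphism_def by blast
  then have "c 0 = 0" using assms(4) by (simp add: c_def \<Psi>_def)
  show ?thesis
  proof (rule that[OF \<open>\<epsilon> > 0\<close>, of W c])
    have "open {q :: plane. snd q \<in> J}"
      using open_vimage_snd[OF J(1)] by (simp add: vimage_def)
    then show "open W" using U'(1) by (auto simp: W_def)
    show "0 \<in> W" "W \<subseteq> U" using U' J U0(3) by (auto simp: W_def)
    show "smooth_on c {-\<epsilon><..<\<epsilon>}" using \<open>smooth_on c J\<close> by (simp add: J_def)
    show "c 0 = 0" by fact
    show "(c has_real_derivative - partial_v F 0 / partial_u F 0) (at 0)"
    proof -
      have "(\<lambda>s. s * (- partial_v F 0 / partial_u F 0)) = (*) (- partial_v F 0 / partial_u F 0)"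
        by (simp add: fun_eq_iff)
      then show ?thesis
        using c_deriv[OF J(2)] unfolding has_field_derivative_def \<open>c 0 = 0\<close> zero_prod_def[symmetric] by metis
    qed
    show "{q \<in> W. F q = 0} = (\<lambda>t. (c t, t)) ` {-\<epsilon><..<\<epsilon>}"
    proof (intro equalityI subsetI)
      fix q assume "q \<in> {q \<in> W. F q = 0}"
      then have q: "q \<in> U'" "snd q \<in> J" "F q = 0" by (auto simp: W_def)
      then have "\<theta> (0, snd q) = q" using hom by (auto simp: homeomorphism_def \<Psi>_def)
      then show "q \<in> (\<lambda>t. (c t, t)) ` {-\<epsilon><..<\<epsilon>}"
        using \<theta>(1)[OF q(2)] q(2) unfolding J_def by force
    next
      fix q assume "q \<in> (\<lambda>t. (c t, t)) ` {-\<epsilon><..<\<epsilon>}"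
      then show "q \<in> {q \<in> W. F q = 0}" using \<theta> by (auto simp: W_def J_def[symmetric])
    qed
  qed
qed

lemma scale_v_in_ball:
  fixes q :: plane
  assumes "q \<in> ball 0 r" "t \<in> {0..1}"
  shows "(fst q, t * snd q) \<in> ball 0 r"
proof -
  have "(t * snd q)\<^sup>2 \<le> (snd q)\<^sup>2"
    using assms(2) by (simp add: abs_le_square_iff[symmetric] abs_mult mult_left_le_one_le)
  then have "norm (fst q, t * snd q) \<le> norm (fst q, snd q)" unfolding norm_Pair by simp
  then show ?thesis using assms(1) by simp
qed

text \<open>Differentiating under the integral turns the integral with weight \<open>t\<^sup>m\<close> into a combination of such integrals
  of \<open>F\<^sub>u\<close> and \<open>F\<^sub>v\<close>, where the inner factor \<open>t\<close> raises the weight of the latter. The weight \<open>t\<^sup>m\<close> is there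
  to make this induction close.\<close>

lemma Ck_on_moment_integral:
  fixes F :: "plane \<Rightarrow> 'b::euclidean_space"
  assumes "smooth_on F (ball 0 r)"
  shows "Ck_on k (\<lambda>q. integral {0..1} (\<lambda>t. t ^ m *\<^sub>R F (fst q, t * snd q))) (ball 0 r)"
proof -
  let ?B = "ball (0 :: plane) r"
  note inB = scale_v_in_ball[where r = r]
  have cont: "continuous_on (?B \<times> {0..1}) (\<lambda>(q, t). t ^ m *\<^sub>R G (fst q, t * snd q))"
    if "smooth_on G ?B" for G :: "plane \<Rightarrow> 'b" and m
  proof -
    have "continuous_on (?B \<times> {0..1}) (\<lambda>x. G (fst (fst x), snd x * snd (fst x)))"
    proof (rule continuous_on_compose2[OF smooth_on_continuous_on[OF that]])
      show "(\<lambda>x. (fst (fst x), snd x * snd (fst x))) ` (?B \<times> {0..1}) \<subseteq> ?B"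
        using inB by force
    qed (intro continuous_intros)
    then show ?thesis by (auto simp: case_prod_beta intro!: continuous_intros)
  qed
  have integrable: "(\<lambda>t. t ^ m *\<^sub>R G (fst q, t * snd q)) integrable_on {0..1}"
    if "smooth_on G ?B" "q \<in> ?B" for G :: "plane \<Rightarrow> 'b" and q m
  proof (rule integrable_continuous_real)
    have "continuous_on {0..1} (\<lambda>t. (\<lambda>(q, t). t ^ m *\<^sub>R G (fst q, t * snd q)) (q, t))"
      by (rule continuous_on_compose2[OF cont[OF that(1), of m]])
        (use that(2) in \<open>auto intro!: continuous_intros\<close>)
    then show "continuous_on {0..1} (\<lambda>t. t ^ m *\<^sub>R G (fst q, t * snd q))" by simp
  qed
  define I where "I m G q = integral {0..1} (\<lambda>t. t ^ m *\<^sub>R G (fst q, t * snd q))"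
    for m and G :: "plane \<Rightarrow> 'b" and q
  have "Ck_on k (I m F) ?B"
    using assms
  proof (induction k arbitrary: F m)
    case 0
    have "continuous_on (?B \<times> cbox 0 1) (\<lambda>(q, t). t ^ m *\<^sub>R F (fst q, t * snd q))"
      unfolding cbox_interval by (rule cont) (rule 0)
    then have "continuous_on ?B (\<lambda>q. integral (cbox 0 1) (\<lambda>t. t ^ m *\<^sub>R F (fst q, t * snd q)))"
      by (rule integral_continuous_on_param)
    then show ?case
      unfolding cbox_interval Ck_on.simps(1) I_def .
  next
    case (Suc k)
    let ?D = "\<lambda>q. frechet_derivative F (at q)"
    define L where "L q t = Blinfun (\<lambda>w. t ^ m *\<^sub>R ?D (fst q, t * snd q) (fst w, t * snd w))" for q t
    have bl: "bounded_linear (\<lambda>w. t ^ m *\<^sub>R ?D (fst q, t * snd q) (fst w, t * snd w))"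
      if "q \<in> ?B" "t \<in> {0..1}" for q t
    proof -
      have "bounded_linear (\<lambda>w :: plane. (fst w, t * snd w))"
        by (intro bounded_linear_Pair bounded_linear_fst bounded_linear_const_mult bounded_linear_snd)
      from bounded_linear_compose[OF
          has_derivative_bounded_linear[OF smooth_on_has_derivative[OF Suc.prems inB[OF that]]] this]
      show ?thesis by (rule bounded_linear_const_scaleR)
    qed
    have app: "blinfun_apply (L q t) w = t ^ m *\<^sub>R ?D (fst q, t * snd q) (fst w, t * snd w)"
      if "q \<in> ?B" "t \<in> {0..1}" for q t w
      unfolding L_def bounded_linear_Blinfun_apply[OF bl[OF that]] ..
    have split: "blinfun_apply (L q t) w = fst w *\<^sub>R (t ^ m *\<^sub>R partial_u F (fst q, t * snd q))
        + snd w *\<^sub>R (t ^ Suc m *\<^sub>R partial_v F (fst q, t * snd q))" if "q \<in> ?B" "t \<in> {0..1}" for q t w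
    proof -
      have l: "linear (?D (fst q, t * snd q))"
        using has_derivative_linear[OF smooth_on_has_derivative[OF Suc.prems inB[OF that]]] .
      show ?thesis
        using linear_plane_decomp[OF l, of "(fst w, t * snd w)"]
        by (simp add: app[OF that] dir_deriv_def algebra_simps)
    qed
    have sm: "smooth_on (partial_u F) ?B" "smooth_on (partial_v F) ?B"
      using Suc.prems by (intro smooth_on_intros; simp)+
    have contL: "continuous_on (?B \<times> cbox 0 1) (\<lambda>(q, t). L q t)"
      unfolding case_prod_beta
    proof (rule continuous_on_blinfun_componentwise)
      fix w :: plane
      have "continuous_on (?B \<times> {0..1}) (\<lambda>x. fst w *\<^sub>R (snd x ^ m *\<^sub>R partial_u F (fst (fst x), snd x * snd (fst x)))
        + snd w *\<^sub>R (snd x ^ Suc m *\<^sub>R partial_v F (fst (fst x), snd x * snd (fst x))))"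
        using cont[OF sm(1), of m] cont[OF sm(2), of "Suc m"]
        by (intro continuous_on_add continuous_on_scaleR[OF continuous_on_const]) (simp_all add: case_prod_beta)
      then show "continuous_on (?B \<times> cbox 0 1) (\<lambda>x. blinfun_apply (L (fst x) (snd x)) w)"
        unfolding cbox_interval by (rule continuous_on_eq) (auto simp: split)
    qed
    have leibniz: "((\<lambda>q. integral (cbox 0 1) (\<lambda>t. t ^ m *\<^sub>R F (fst q, t * snd q))) has_derivative
        blinfun_apply (integral (cbox 0 1) (L q))) (at q within ?B)" if "q \<in> ?B" for q
    proof (rule leibniz_rule[OF _ _ contL that convex_ball])
      fix q t assume q: "q \<in> ?B" and "t \<in> cbox (0::real) 1"
      then have t: "t \<in> {0..1}" by simp
      have "((\<lambda>q. (fst q, t * snd q)) has_derivative (\<lambda>w. (fst w, t * snd w))) (at q)"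
        by (auto intro!: derivative_eq_intros)
      from has_derivative_scaleR_right[OF has_derivative_compose[OF this smooth_on_has_derivative[OF Suc.prems inB[OF q t]]], of "t ^ m"]
      show "((\<lambda>q. t ^ m *\<^sub>R F (fst q, t * snd q)) has_derivative blinfun_apply (L q t)) (at q within ?B)"
        unfolding L_def bounded_linear_Blinfun_apply[OF bl[OF q t]]
        by (rule has_derivative_at_withinI)
    qed (use integrable[OF Suc.prems] in simp)
    have der: "(I m F has_derivative
        blinfun_apply (integral {0..1} (L q))) (at q)" if "q \<in> ?B" for q
      using leibniz[OF that] unfolding I_def[abs_def] cbox_interval at_within_open[OF that open_ball] .
    have eq: "blinfun_apply (integral {0..1} (L q)) w
      = fst w *\<^sub>R I m (partial_u F) q + snd w *\<^sub>R I (Suc m) (partial_v F) q"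
      if q: "q \<in> ?B" for q w
    proof -
      have "continuous_on {0..1} (L q)"
      proof -
        have "continuous_on {0..1} (\<lambda>t. (\<lambda>(q, t). L q t) (q, t))"
          by (rule continuous_on_compose2[OF contL]) (use q in \<open>auto intro!: continuous_intros\<close>)
        then show ?thesis by simp
      qed
      then have "blinfun_apply (integral {0..1} (L q)) w = integral {0..1} (\<lambda>t. blinfun_apply (L q t) w)"
        by (intro blinfun_apply_integral integrable_continuous_real)
      also have "\<dots> = integral {0..1} (\<lambda>t. fst w *\<^sub>R (t ^ m *\<^sub>R partial_u F (fst q, t * snd q))
        + snd w *\<^sub>R (t ^ Suc m *\<^sub>R partial_v F (fst q, t * snd q)))"
        by (rule integral_cong) (rule split[OF q])
      also have "\<dots> = integral {0..1} (\<lambda>t. fst w *\<^sub>R (t ^ m *\<^sub>R partial_u F (fst q, t * snd q)))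
        + integral {0..1} (\<lambda>t. snd w *\<^sub>R (t ^ Suc m *\<^sub>R partial_v F (fst q, t * snd q)))"
        by (rule integral_add[OF integrable_cmul integrable_cmul])
          (rule integrable[OF sm(1) q] integrable[OF sm(2) q])+
      finally show ?thesis by (simp only: I_def integral_cmul)
    qed
    have "(I m F has_derivative (\<lambda>w. fst w *\<^sub>R I m (partial_u F) q + snd w *\<^sub>R I (Suc m) (partial_v F) q)) (at q)"
      if q: "q \<in> ?B" for q
    proof -
      have "blinfun_apply (integral {0..1} (L q)) = (\<lambda>w. fst w *\<^sub>R I m (partial_u F) q + snd w *\<^sub>R I (Suc m) (partial_v F) q)"
        using eq[OF q] by (rule ext)
      then show ?thesis using der[OF q] by (simp only:)
    qed
    moreover have "Ck_on k (\<lambda>q. fst w *\<^sub>R I m (partial_u F) q + snd w *\<^sub>R I (Suc m) (partial_v F) q) ?B" for w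
      by (intro Ck_on_add[OF open_ball] Ck_on_bounded_linear[OF open_ball bounded_linear_scaleR_right]
          Suc.IH sm)
    ultimately show ?case by (rule Ck_on_SucI[OF open_ball])
  qed
  then show ?thesis unfolding I_def[abs_def] .
qed

text \<open>Hadamard's lemma: \<open>F(u, v) = v \<cdot> \<integral>\<^sub>0\<^sup>1 F\<^sub>v(u, t v) dt\<close> when \<open>F\<close> vanishes on the \<open>u\<close>-axis, so the quotient
  \<open>F / v\<close> is an integral that depends smoothly on the parameters, also across the axis.\<close>

lemma smooth_on_div_v:
  fixes F :: "plane \<Rightarrow> 'b::euclidean_space"
  assumes "smooth_on F (ball 0 r)" and axis: "\<And>q. q \<in> ball 0 r \<Longrightarrow> snd q = 0 \<Longrightarrow> F q = 0"
  shows "smooth_on (div_v F) (ball 0 r)"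
proof -
  let ?B = "ball (0 :: plane) r"
  have "smooth_on (partial_v F) ?B" using assms(1) by (intro smooth_on_intros; simp)
  then have "smooth_on (\<lambda>q. integral {0..1} (\<lambda>t. t ^ 0 *\<^sub>R partial_v F (fst q, t * snd q))) ?B"
    unfolding smooth_on_def using Ck_on_moment_integral smooth_on_def by blast
  moreover have "integral {0..1} (\<lambda>t. t ^ 0 *\<^sub>R partial_v F (fst q, t * snd q)) = div_v F q"
    if q: "q \<in> ?B" for q
  proof (cases "snd q = 0")
    case True
    then have "q = (fst q, 0)" by (simp add: prod_eq_iff)
    then show ?thesis using True by (simp add: div_v_def)
  next
    case False
    note inB = scale_v_in_ball[OF q]
    have "((\<lambda>t. F (fst q, t * snd q)) has_vector_derivative snd q *\<^sub>R partial_v F (fst q, t * snd q)) (at t within {0..1})"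
      if "t \<in> {0..1}" for t
    proof -
      note DF = smooth_on_has_derivative[OF assms(1) inB[OF that]]
      have "((\<lambda>t. (fst q, t * snd q)) has_derivative (\<lambda>s. (s * snd q) *\<^sub>R (0, 1))) (at t)"
        by (auto intro!: derivative_eq_intros simp: zero_prod_def)
      from has_derivative_compose[OF this DF]
      show ?thesis
        unfolding has_vector_derivative_def dir_deriv_def
        by (simp only: linear_cmul[OF has_derivative_linear[OF DF]] scaleR_scaleR)
          (rule has_derivative_at_withinI)
    qed
    then have "((\<lambda>t. snd q *\<^sub>R partial_v F (fst q, t * snd q)) has_integral
        F (fst q, 1 * snd q) - F (fst q, 0 * snd q)) {0..1}"
      by (intro fundamental_theorem_of_calculus) simp_all
    moreover have "F (fst q, 0 * snd q) = 0"
      using axis[OF inB[of 0]] by simp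
    ultimately have "((\<lambda>t. snd q *\<^sub>R partial_v F (fst q, t * snd q)) has_integral F q) {0..1}" by simp
    from has_integral_cmul[OF this, of "inverse (snd q)"] False
    have "((\<lambda>t. partial_v F (fst q, t * snd q)) has_integral inverse (snd q) *\<^sub>R F q) {0..1}" by simp
    then show ?thesis using False by (simp add: div_v_def integral_unique)
  qed
  ultimately show ?thesis
    using smooth_on_cong[OF open_ball, of 0 r "\<lambda>q. integral {0..1} (\<lambda>t. t ^ 0 *\<^sub>R partial_v F (fst q, t * snd q))" "div_v F"]
    by blast
qed


section \<open>Linear algebra in the plane and in space\<close>

lemma dim_range_less_2_iff:
  fixes A :: "plane \<Rightarrow> 'b::euclidean_space"
  assumes "linear A"
  shows "dim (range A) < 2 \<longleftrightarrow> (\<exists>w. w \<noteq> 0 \<and> A w = 0)"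
proof
  assume "dim (range A) < 2"
  moreover have "dim (range A) = 2" if "inj A"
    using dim_image_eq[OF assms, of UNIV] that by (simp add: dim_UNIV)
  ultimately show "\<exists>w. w \<noteq> 0 \<and> A w = 0"
    using linear_injective_0[OF assms] by auto
next
  assume "\<exists>w. w \<noteq> 0 \<and> A w = 0"
  then obtain w where w: "w \<noteq> 0" "fst w *\<^sub>R A (1, 0) + snd w *\<^sub>R A (0, 1) = 0"
    using linear_plane_decomp[OF assms] by metis
  obtain b where "A (1, 0) \<in> span {b}" "A (0, 1) \<in> span {b}"
  proof (cases "fst w = 0")
    case True
    then have "snd w \<noteq> 0" using w(1) by (simp add: prod_eq_iff)
    then show ?thesis using that[of "A (1, 0)"] w(2) True by (simp add: span_base span_zero)
  next
    case False
    have "A (1, 0) = (inverse (fst w) * fst w) *\<^sub>R A (1, 0)" using False by simp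
    also have "\<dots> = inverse (fst w) *\<^sub>R (- (snd w *\<^sub>R A (0, 1)))"
      using w(2) by (simp only: eq_neg_iff_add_eq_0[symmetric] scaleR_scaleR[symmetric])
    finally have "A (1, 0) = (- inverse (fst w) * snd w) *\<^sub>R A (0, 1)" by simp
    then have "A (1, 0) \<in> span {A (0, 1)}" by (metis insertI1 span_base span_scale)
    then show ?thesis using that[of "A (0, 1)"] by (simp add: span_base)
  qed
  then have "range A \<subseteq> span {b}"
    using linear_plane_decomp[OF assms] by (metis image_subsetI span_add span_scale)
  then have "dim (range A) \<le> card {b}" by (intro dim_le_card) auto
  then show "dim (range A) < 2" by simp
qed

lemma singular_set_iff:
  assumes "f differentiable at q"
  shows "q \<in> singular_set f \<longleftrightarrow> (\<exists>w. w \<noteq> 0 \<and> frechet_derivative f (at q) w = 0)"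
  unfolding singular_set_def using dim_range_less_2_iff[OF linear_frechet_derivative[OF assms]] by simp

lemma lin_indep2_scaleR: "\<not> lin_indep2 (c *\<^sub>R y) y"
proof
  assume "lin_indep2 (c *\<^sub>R y) y"
  then have "c *\<^sub>R y \<noteq> y" "independent {c *\<^sub>R y, y}" by (simp_all add: lin_indep2_def)
  then show False using independent_insert[of "c *\<^sub>R y" "{y}"] by (auto simp: span_singleton)
qed

lemma not_lin_indep2D:
  assumes "\<not> lin_indep2 x y" "y \<noteq> 0"
  obtains c where "x = c *\<^sub>R y"
proof (cases "x = y")
  case True
  then show ?thesis using that[of 1] by simp
next
  case False
  then have "dependent {x, y}" using assms(1) by (simp add: lin_indep2_def)
  then have "x \<in> span {y}" using False assms(2) independent_insert[of x "{y}"] by (auto simp: dependent_single)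
  then show ?thesis using that by (auto simp: span_singleton)
qed

lemma det3_cross: "det3 a b c = a \<bullet> cross3 b c"
  by (simp add: det3_def dot_cross_det)

lemma det3_scaleR: "det3 a (k *\<^sub>R b) c = k * det3 a b c" "det3 a b (k *\<^sub>R c) = k * det3 a b c"
    "det3 (k *\<^sub>R a) b c = k * det3 a b c"
  by (simp_all add: det3_cross cross_mult_left cross_mult_right)

lemma det3_swap_arg: "det3 a (k *\<^sub>R b - l *\<^sub>R a) c = k * det3 a b c"
  by (simp add: det3_cross Cross3.left_diff_distrib cross_mult_left inner_diff_right dot_cross_self)

text \<open>For \<open>c\<close> orthogonal to \<open>a\<close> and \<open>b\<close>, both the inner and the cross product of \<open>c\<close> with the unit vector
  \<open>a \<times> b\<close> vanish; the first of them is the determinant.\<close>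

lemma det3_eq_0_orthonormal:
  assumes "norm a = 1" "norm b = 1" "a \<bullet> b = 0" "c \<bullet> a = 0" "c \<bullet> b = 0" "det3 a b c = 0"
  shows "c = 0"
proof -
  have "c \<bullet> cross3 a b = det3 a b c"
    by (simp add: det3_def det_3 cross3_def inner_vec_def sum_3 vector_def algebra_simps)
  moreover have "cross3 c (cross3 a b) = 0"
    using Lagrange[of c a b] assms(4,5) by simp
  moreover have "(norm (cross3 a b))\<^sup>2 = 1"
    using norm_cross_dot[of a b] assms(1-3) by simp
  ultimately have "(norm c)\<^sup>2 = 0"
    using norm_cross_dot[of c "cross3 a b"] assms(6) by (simp add: power_mult_distrib)
  then show ?thesis by simp
qed

lemma orthonormal3_det3: "orthonormal3 a b c \<Longrightarrow> det3 a b c \<noteq> 0"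
  using det3_eq_0_orthonormal[of a b c] by (auto simp: orthonormal3_def inner_commute)

lemma orthogonal_to_frame:
  assumes "det3 a b c \<noteq> 0" "a \<bullet> z = 0" "b \<bullet> z = 0" "c \<bullet> z = 0"
  shows "z = 0"
proof -
  let ?A = "vector [a, b, c] :: real^3^3"
  have "?A *v z = 0"
    using assms(2-4) by (simp add: vec_eq_iff forall_3 matrix_vector_mul_component)
  moreover have "invertible ?A"
    using assms(1) by (simp add: det3_def invertible_det_nz)
  ultimately show ?thesis
    by (metis invertible_def matrix_left_invertible_ker)
qed

lemma bounded_bilinear_cross3: "bounded_bilinear cross3"
  using bilinear_cross bilinear_conv_bounded_bilinear by blast

lemma smooth_on_det3:
  "open U \<Longrightarrow> smooth_on a U \<Longrightarrow> smooth_on b U \<Longrightarrow> smooth_on c U \<Longrightarrow>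
    smooth_on (\<lambda>q. det3 (a q) (b q) (c q)) U"
  unfolding det3_cross by (intro smooth_on_inner smooth_on_bounded_bilinear[OF _ bounded_bilinear_cross3])

lemma inner_eq_const_derivative:
  fixes f g :: "'a::real_normed_vector \<Rightarrow> 'b::real_inner"
  assumes "open U" "smooth_on f U" "smooth_on g U" "\<And>q. q \<in> U \<Longrightarrow> f q \<bullet> g q = c" "q \<in> U"
  shows "frechet_derivative f (at q) w \<bullet> g q + f q \<bullet> frechet_derivative g (at q) w = 0"
proof -
  have "((\<lambda>q. f q \<bullet> g q) has_derivative
      (\<lambda>w. f q \<bullet> frechet_derivative g (at q) w + frechet_derivative f (at q) w \<bullet> g q)) (at q)"
    by (intro has_derivative_inner smooth_on_has_derivative[OF _ assms(5)] assms(2,3))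
  moreover have "((\<lambda>q. f q \<bullet> g q) has_derivative (\<lambda>_. 0)) (at q)"
    by (rule has_derivative_transform_within_open[OF has_derivative_const[of c] assms(1,5)]) (simp add: assms(4))
  ultimately have "(\<lambda>w. f q \<bullet> frechet_derivative g (at q) w + frechet_derivative f (at q) w \<bullet> g q) = (\<lambda>_. 0)"
    by (rule has_derivative_unique)
  then show ?thesis by (metis add.commute)
qed

lemma open_nonzero_set:
  fixes g :: "'a::real_normed_vector \<Rightarrow> 'b::real_normed_vector"
  assumes "open U" "smooth_on g U"
  shows "open {q \<in> U. g q \<noteq> 0}"
proof -
  have "{q \<in> U. g q \<noteq> 0} = g -` (- {0}) \<inter> U" by auto
  then show ?thesis
    using continuous_on_open_vimage[OF assms(1), of g] smooth_on_continuous_on[OF assms(2)]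
    by (metis closed_singleton open_Compl)
qed


section \<open>Frontals in adapted coordinates\<close>

locale frontal_chart =
  fixes f \<nu> :: "plane \<Rightarrow> space" and B :: "plane set"
  assumes open_B: "open B"
    and smooth_f: "smooth_on f B" and smooth_\<nu>: "smooth_on \<nu> B"
    and unit: "q \<in> B \<Longrightarrow> norm (\<nu> q) = 1"
    and normal: "q \<in> B \<Longrightarrow> frechet_derivative f (at q) X \<bullet> \<nu> q = 0"
begin

text \<open>Both sides equal \<open>- f\<^sub>u\<^sub>v \<bullet> \<nu>\<close>, by differentiating \<open>f\<^sub>u \<bullet> \<nu> = 0\<close> and \<open>f\<^sub>v \<bullet> \<nu> = 0\<close>.\<close>

lemma weingarten_symmetric:
  assumes "q \<in> B"
  shows "partial_u f q \<bullet> partial_v \<nu> q = partial_v f q \<bullet> partial_u \<nu> q"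
proof -
  let ?D = "\<lambda>w q. frechet_derivative f (at q) w"
  have "frechet_derivative (?D a) (at q) b \<bullet> \<nu> q + ?D a q \<bullet> frechet_derivative \<nu> (at q) b = 0" for a b
    by (rule inner_eq_const_derivative[OF open_B smooth_on_frechet_derivative[OF smooth_f] smooth_\<nu> _ assms])
      (rule normal)
  from this[of "(1, 0)" "(0, 1)"] this[of "(0, 1)" "(1, 0)"]
  show ?thesis
    using symmetric_second_derivative[OF open_B smooth_f assms, of "(1, 0)" "(0, 1)"]
    by (simp add: dir_deriv_def)
qed

lemma \<nu>_orthogonal_derivative: "q \<in> B \<Longrightarrow> \<nu> q \<bullet> frechet_derivative \<nu> (at q) w = 0"
  using inner_eq_const_derivative[OF open_B smooth_\<nu> smooth_\<nu>, of 1 q w] unit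
  by (simp add: inner_commute dot_square_norm)

end


text \<open>A frontal in adapted coordinates. On the axis \<open>\<nu>\<^sub>v = 0\<close> is what the vanishing of \<open>\<psi>\<close> at pure-frontal
  points amounts to. The domain is a ball so that it contains, with each point, the vertical segment to the axis,
  along which Hadamard's lemma integrates.\<close>

locale adapted_chart = frontal_chart +
  fixes r :: real
  assumes B_eq: "B = ball 0 r" and radius: "0 < r"
    and f_v_axis: "q \<in> B \<Longrightarrow> snd q = 0 \<Longrightarrow> partial_v f q = 0"
    and \<nu>_v_axis: "q \<in> B \<Longrightarrow> snd q = 0 \<Longrightarrow> partial_v \<nu> q = 0"
    and frame_0: "orthonormal3 (partial_u f 0) (partial_v (partial_v f) 0) (\<nu> 0)"
begin

lemma zero_in_B: "0 \<in> B"
  using radius by (simp add: B_eq)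

lemma smooth_partials:
  "smooth_on (partial_u f) B" "smooth_on (partial_v f) B"
  "smooth_on (partial_u \<nu>) B" "smooth_on (partial_v \<nu>) B"
  by (intro smooth_on_dir_deriv smooth_on_const smooth_f smooth_\<nu> open_B)+

lemma smooth_h: "smooth_on (h_fun f) B"
  unfolding h_fun_def B_eq
  by (rule smooth_on_div_v) (use smooth_partials(2) f_v_axis in \<open>simp_all only: B_eq\<close>)

lemma smooth_\<nu>1: "smooth_on (nu1_fun \<nu>) B"
  unfolding nu1_fun_def B_eq
  by (rule smooth_on_div_v) (use smooth_partials(4) \<nu>_v_axis in \<open>simp_all only: B_eq\<close>)

lemma f_v_eq: "q \<in> B \<Longrightarrow> partial_v f q = snd q *\<^sub>R h_fun f q"
  using f_v_axis by (simp add: h_fun_def div_v_def)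

lemma \<nu>_v_eq: "q \<in> B \<Longrightarrow> partial_v \<nu> q = snd q *\<^sub>R nu1_fun \<nu> q"
  using \<nu>_v_axis by (simp add: nu1_fun_def div_v_def)

lemma smooth_forms:
  "smooth_on (E_til f) B" "smooth_on (F_til f) B" "smooth_on (G_til f) B"
  "smooth_on (L_til f \<nu>) B" "smooth_on (M_til f \<nu>) B" "smooth_on (N1_til f \<nu>) B"
  unfolding E_til_def[abs_def] F_til_def[abs_def] G_til_def[abs_def]
    L_til_def[abs_def] M_til_def[abs_def] N1_til_def[abs_def]
  by (intro smooth_on_minus smooth_on_inner open_B smooth_partials smooth_h smooth_\<nu>1)+

lemma forms_0: "E_til f 0 = 1" "F_til f 0 = 0" "G_til f 0 = 1"
  using frame_0 
  by (simp_all add: E_til_def F_til_def G_til_def h_fun_def div_v_def orthonormal3_def dot_square_norm)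

lemma frame_det_0: "det3 (partial_u f 0) (h_fun f 0) (\<nu> 0) \<noteq> 0"
  using orthonormal3_det3[OF frame_0] by (simp add: h_fun_def div_v_def)

definition disc :: "plane \<Rightarrow> real" where
  "disc q = (mean_curv f \<nu> q)\<^sup>2 - gauss_curv f \<nu> q"

definition first_form_det :: "plane \<Rightarrow> real" where
  "first_form_det q = E_til f q * G_til f q - (F_til f q)\<^sup>2"

text \<open>The characteristic equation of the shape operator in the basis \<open>f\<^sub>u, h\<close>. In this factored form it says that
  the vector \<open>focal_x\<close> is principal, and at \<open>0\<close>, if \<open>\<kappa>\<^sub>t \<noteq> 0\<close>, that the factor \<open>L - \<kappa> E\<close> (tildes omitted) does not
  vanish.\<close>

lemma principal_curv_quadratic:
  fixes q :: plane and j :: nat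
  assumes "first_form_det q \<noteq> 0" "disc q \<ge> 0"
  defines "\<kappa> \<equiv> principal_curv f \<nu> j q"
  shows "(L_til f \<nu> q - \<kappa> * E_til f q) * (N1_til f \<nu> q - \<kappa> * G_til f q) = (M_til f \<nu> q - \<kappa> * F_til f q)\<^sup>2"
proof -
  let ?H = "mean_curv f \<nu> q" and ?K = "gauss_curv f \<nu> q" and ?W = "first_form_det q"
  have "(\<kappa> - ?H)\<^sup>2 = ?H\<^sup>2 - ?K"
    using assms(2) by (simp add: \<kappa>_def principal_curv_def disc_def)
  then have "?W * \<kappa>\<^sup>2 - (2 * ?W * ?H) * \<kappa> + ?W * ?K = 0" by algebra
  moreover have "2 * ?W * ?H = E_til f q * N1_til f \<nu> q - 2 * F_til f q * M_til f \<nu> q + G_til f q * L_til f \<nu> q"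
    "?W * ?K = L_til f \<nu> q * N1_til f \<nu> q - (M_til f \<nu> q)\<^sup>2"
    using assms(1) by (simp_all add: mean_curv_def gauss_curv_def first_form_det_def)
  ultimately show ?thesis unfolding first_form_det_def by algebra
qed

lemma smooth_first_form_det: "smooth_on first_form_det B"
  unfolding first_form_det_def[abs_def]
  by (intro smooth_on_diff smooth_on_mult smooth_on_power2 smooth_forms open_B)

lemma smooth_curvatures:
  assumes "open D" "D \<subseteq> B" "\<And>q. q \<in> D \<Longrightarrow> first_form_det q \<noteq> 0"
  shows "smooth_on (mean_curv f \<nu>) D" "smooth_on disc D"
proof -
  have *: "smooth_on (E_til f) D" "smooth_on (F_til f) D" "smooth_on (G_til f) D"
    "smooth_on (L_til f \<nu>) D" "smooth_on (M_til f \<nu>) D" "smooth_on (N1_til f \<nu>) D"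
    using smooth_forms smooth_on_subset assms(2) by blast+
  show H: "smooth_on (mean_curv f \<nu>) D"
    unfolding mean_curv_def[abs_def]
    by (intro smooth_on_intros * assms(1)) (use assms(3) in \<open>simp add: first_form_det_def\<close>)
  have K: "smooth_on (gauss_curv f \<nu>) D"
    unfolding gauss_curv_def[abs_def]
    by (intro smooth_on_intros * assms(1)) (use assms(3) in \<open>simp add: first_form_det_def\<close>)
  show "smooth_on disc D"
    unfolding disc_def[abs_def] by (intro smooth_on_diff smooth_on_power2 H K assms(1))
qed

lemma smooth_principal_curv:
  assumes "open D" "D \<subseteq> B" "\<And>q. q \<in> D \<Longrightarrow> first_form_det q \<noteq> 0" "\<And>q. q \<in> D \<Longrightarrow> disc q > 0"
  shows "smooth_on (principal_curv f \<nu> j) D"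
proof -
  note H = smooth_curvatures[OF assms(1-3)]
  have s: "smooth_on (\<lambda>q. sqrt (disc q)) D"
    by (intro smooth_on_sqrt assms(1,4) H)
  show ?thesis
    unfolding principal_curv_def[abs_def] disc_def[symmetric]
    by (cases "j = 1") (simp_all add: smooth_on_add smooth_on_diff H s assms(1))
qed

lemma smooth_principal_vector:
  assumes "open D" "D \<subseteq> B" "smooth_on (principal_curv f \<nu> j) D"
  shows "smooth_on (principal_vector f \<nu> j) D" "smooth_on (focal_x f \<nu> j) D"
proof -
  have *: "smooth_on (E_til f) D" "smooth_on (F_til f) D" 
    "smooth_on (L_til f \<nu>) D" "smooth_on (M_til f \<nu>) D" "smooth_on (partial_u f) D" "smooth_on (h_fun f) D"
    using smooth_forms smooth_partials smooth_h smooth_on_subset assms(2) by blast+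
  show "smooth_on (principal_vector f \<nu> j) D"
    unfolding principal_vector_def[abs_def]
    by (intro smooth_on_Pair smooth_on_mult smooth_on_minus smooth_on_diff smooth_on_snd smooth_on_ident * assms)
  show "smooth_on (focal_x f \<nu> j) D"
    unfolding focal_x_def[abs_def]
    by (intro smooth_on_add smooth_on_scaleR smooth_on_mult smooth_on_minus smooth_on_diff * assms)
qed

text \<open>All conditions are open, so it is enough to check them at \<open>0\<close>. There the frame is orthonormal, which gives
  \<open>E = G = 1\<close>, \<open>F = 0\<close> and \<open>H\<^sup>2 - K = ((N - L) / 2)\<^sup>2 + M\<^sup>2\<close>; the hypothesis \<open>M \<noteq> 0\<close> enters here. The domain shrinks
  in stages because the principal curvature is known to be smooth only where \<open>H\<^sup>2 - K > 0\<close>.\<close>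

lemma regular_domain_exists:
  assumes "M_til f \<nu> 0 \<noteq> 0" "\<forall>\<^sub>F q in nhds 0. principal_curv f \<nu> j q \<noteq> 0"
  obtains D where "open D" "0 \<in> D" "D \<subseteq> B"
    "\<And>q. q \<in> D \<Longrightarrow> first_form_det q \<noteq> 0 \<and> disc q > 0 \<and> principal_curv f \<nu> j q \<noteq> 0 \<and>
      snd (principal_vector f \<nu> j q) \<noteq> 0 \<and> focal_x f \<nu> j q \<noteq> 0 \<and>
      det3 (partial_u f q) (h_fun f q) (\<nu> q) \<noteq> 0"
proof -
  define D1 where "D1 = {q \<in> B. first_form_det q \<noteq> 0}"
  have W0: "first_form_det 0 = 1" by (simp add: first_form_det_def forms_0)
  have D1: "open D1" "0 \<in> D1" "D1 \<subseteq> B" "\<And>q. q \<in> D1 \<Longrightarrow> first_form_det q \<noteq> 0"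
    using open_nonzero_set[OF open_B smooth_first_form_det] zero_in_B W0 by (auto simp: D1_def)
  let ?l = "L_til f \<nu> 0" and ?m = "M_til f \<nu> 0" and ?n = "N1_til f \<nu> 0"
  have "disc 0 = ((?n - ?l) / 2)\<^sup>2 + ?m\<^sup>2"
    by (simp add: disc_def mean_curv_def gauss_curv_def forms_0 power2_eq_square field_simps)
  then have disc0: "disc 0 > 0" using assms(1) by (simp add: add_nonneg_pos)
  have disc_cont: "continuous_on D1 disc"
    by (rule smooth_on_continuous_on[OF smooth_curvatures(2)[OF D1(1,3,4)]])
  define D2 where "D2 = D1 \<inter> disc -` {0<..}"
  have D2: "open D2" "0 \<in> D2" "D2 \<subseteq> D1" "\<And>q. q \<in> D2 \<Longrightarrow> disc q > 0"
    using continuous_open_preimage[OF disc_cont D1(1), of "{0<..}"] D1(2) disc0 by (auto simp: D2_def)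
  have D2B: "D2 \<subseteq> B" using D1(3) D2(3) by blast
  have \<kappa>: "smooth_on (principal_curv f \<nu> j) D2"
    by (rule smooth_principal_curv[OF D2(1) D2B _ D2(4)]) (use D2(3) D1(4) in auto)
  note V = smooth_principal_vector[OF D2(1) D2B \<kappa>]
  let ?V2 = "\<lambda>q. snd (principal_vector f \<nu> j q)"
  let ?det = "\<lambda>q. det3 (partial_u f q) (h_fun f q) (\<nu> q)"
  have sm: "smooth_on ?V2 D2" "smooth_on ?det D2"
    using smooth_partials(1) smooth_h smooth_\<nu> smooth_on_subset[OF _ D2B]
    by (auto intro!: smooth_on_snd smooth_on_det3 V D2(1))
  have V0: "?V2 0 \<noteq> 0"
    using principal_curv_quadratic[of 0 j] W0 disc0 assms(1)
    by (auto simp: principal_vector_def forms_0)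
  have "focal_x f \<nu> j 0 \<bullet> h_fun f 0 = ?V2 0"
    using forms_0 by (simp add: focal_x_def principal_vector_def inner_add_left inner_diff_left F_til_def G_til_def)
  then have x0: "focal_x f \<nu> j 0 \<noteq> 0" using V0 by auto
  obtain D3 where D3: "open D3" "0 \<in> D3" "\<And>q. q \<in> D3 \<Longrightarrow> principal_curv f \<nu> j q \<noteq> 0"
    using assms(2) unfolding eventually_nhds by blast
  define D where "D = D3 \<inter> {q \<in> D2. ?V2 q \<noteq> 0} \<inter> {q \<in> D2. focal_x f \<nu> j q \<noteq> 0} \<inter> {q \<in> D2. ?det q \<noteq> 0}"
  show ?thesis
  proof (rule that)
    show "open D" unfolding D_def
      by (intro open_Int D3(1) open_nonzero_set D2(1) sm V)
    show "0 \<in> D" using D3(2) D2(2) V0 x0 frame_det_0 by (simp add: D_def)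
    show "D \<subseteq> B" using D2B by (auto simp: D_def)
    show "first_form_det q \<noteq> 0 \<and> disc q > 0 \<and> principal_curv f \<nu> j q \<noteq> 0 \<and>
      snd (principal_vector f \<nu> j q) \<noteq> 0 \<and> focal_x f \<nu> j q \<noteq> 0 \<and>
      det3 (partial_u f q) (h_fun f q) (\<nu> q) \<noteq> 0" if "q \<in> D" for q
    proof -
      have "q \<in> D2" using that by (simp add: D_def)
      then show ?thesis
        using that D1(4)[of q] D2(4)[of q] D3(3)[of q] subsetD[OF D2(3)] by (simp add: D_def)
    qed
  qed
qed

end


section \<open>The focal surface\<close>

text \<open>The neighbourhood \<open>D\<close> of \<open>0\<close> on which the principal curvature is smooth and the frame, the principal vector
  and the normal of the focal surface do not degenerate.\<close>

locale focal_chart = adapted_chart +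
  fixes j :: nat and D :: "plane set"
  assumes open_D: "open D" and zero_in_D: "0 \<in> D" and D_subset_B: "D \<subseteq> B"
    and first_form_det_nonzero: "q \<in> D \<Longrightarrow> first_form_det q \<noteq> 0"
    and disc_pos: "q \<in> D \<Longrightarrow> disc q > 0"
    and curv_nonzero: "q \<in> D \<Longrightarrow> principal_curv f \<nu> j q \<noteq> 0"
    and vector_v_nonzero: "q \<in> D \<Longrightarrow> snd (principal_vector f \<nu> j q) \<noteq> 0"
    and focal_x_nonzero: "q \<in> D \<Longrightarrow> focal_x f \<nu> j q \<noteq> 0"
    and frame_det_nonzero: "q \<in> D \<Longrightarrow> det3 (partial_u f q) (h_fun f q) (\<nu> q) \<noteq> 0"
begin

abbreviation \<kappa> :: "plane \<Rightarrow> real" where "\<kappa> \<equiv> principal_curv f \<nu> j"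
abbreviation V :: "plane \<Rightarrow> plane" where "V \<equiv> principal_vector f \<nu> j"
abbreviation C :: "plane \<Rightarrow> space" where "C \<equiv> focal_surface f \<nu> j"
abbreviation e :: "plane \<Rightarrow> space" where "e \<equiv> focal_normal f \<nu> j"

definition V\<kappa> :: "plane \<Rightarrow> real" where "V\<kappa> = dir_deriv V \<kappa>"

lemma in_B: "q \<in> D \<Longrightarrow> q \<in> B"
  using D_subset_B by blast

lemma smooth_\<kappa>: "smooth_on \<kappa> D"
  by (intro smooth_principal_curv open_D D_subset_B first_form_det_nonzero disc_pos)

lemma smooth_V: "smooth_on V D" and smooth_x: "smooth_on (focal_x f \<nu> j) D"
  using smooth_principal_vector[OF open_D D_subset_B smooth_\<kappa>] by blast+

lemma smooth_V\<kappa>: "smooth_on V\<kappa> D"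
  unfolding V\<kappa>_def by (intro smooth_on_dir_deriv open_D smooth_\<kappa> smooth_V)

lemma smooth_f_D: "smooth_on f D" and smooth_\<nu>_D: "smooth_on \<nu> D"
  using smooth_f smooth_\<nu> smooth_on_subset D_subset_B by blast+

lemma smooth_C: "smooth_on C D"
  unfolding focal_surface_def[abs_def]
  by (intro smooth_on_add smooth_on_scaleR smooth_on_divide smooth_on_const
      smooth_f_D smooth_\<nu>_D smooth_\<kappa> curv_nonzero open_D)

lemma smooth_e: "smooth_on e D"
proof -
  have "smooth_on (\<lambda>q. inverse (sqrt (focal_x f \<nu> j q \<bullet> focal_x f \<nu> j q)) *\<^sub>R focal_x f \<nu> j q) D"
    using focal_x_nonzero
    by (intro smooth_on_scaleR smooth_on_inverse smooth_on_sqrt smooth_on_inner smooth_x open_D) simp_all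
  then show ?thesis
    unfolding focal_normal_def[abs_def] norm_eq_sqrt_inner by (simp add: divideR_right)
qed

lemma C_derivative:
  assumes q: "q \<in> D"
  shows "frechet_derivative C (at q) w = frechet_derivative f (at q) w
    + (1 / \<kappa> q) *\<^sub>R frechet_derivative \<nu> (at q) w
    - (frechet_derivative \<kappa> (at q) w / (\<kappa> q)\<^sup>2) *\<^sub>R \<nu> q"
proof -
  note d = smooth_on_has_derivative[OF smooth_f_D q] smooth_on_has_derivative[OF smooth_\<nu>_D q]
    smooth_on_has_derivative[OF smooth_\<kappa> q]
  have "((\<lambda>q. 1 / \<kappa> q) has_derivative (\<lambda>w. - (frechet_derivative \<kappa> (at q) w / (\<kappa> q)\<^sup>2))) (at q)"
    using Deriv.has_derivative_inverse[OF curv_nonzero[OF q] d(3)]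
    by (simp add: inverse_eq_divide power2_eq_square)
  from has_derivative_add[OF d(1) has_derivative_scaleR[OF this d(2)]]
  have "(C has_derivative (\<lambda>w. frechet_derivative f (at q) w + ((1 / \<kappa> q) *\<^sub>R frechet_derivative \<nu> (at q) w
    + (- (frechet_derivative \<kappa> (at q) w / (\<kappa> q)\<^sup>2)) *\<^sub>R \<nu> q))) (at q)"
    unfolding focal_surface_def[abs_def] .
  from frechet_derivative_at[OF this, symmetric] show ?thesis by simp
qed

text \<open>Rodrigues' equation. On the axis both sides are zero, since \<open>V\<close> is vertical there and \<open>f\<^sub>v = \<nu>\<^sub>v = 0\<close>. Off the
  axis a factor \<open>v\<close> can be removed, and the remaining identity is tested against the frame \<open>f\<^sub>u, h, \<nu>\<close>: against
  \<open>f\<^sub>u\<close> it is the symmetry of the shape operator, against \<open>h\<close> the characteristic equation.\<close>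

lemma principal_direction:
  assumes q: "q \<in> D"
  shows "frechet_derivative \<nu> (at q) (V q) = - \<kappa> q *\<^sub>R frechet_derivative f (at q) (V q)"
proof -
  have qB: "q \<in> B" using in_B[OF q] .
  let ?a = "M_til f \<nu> q - \<kappa> q * F_til f q" and ?b = "L_til f \<nu> q - \<kappa> q * E_til f q"
  let ?h = "h_fun f q" and ?n1 = "nu1_fun \<nu> q" and ?x = "focal_x f \<nu> j q"
  have V: "V q = (- snd q * ?a, ?b)" by (simp add: principal_vector_def)
  have x: "?x = (- ?a) *\<^sub>R partial_u f q + ?b *\<^sub>R ?h" by (simp add: focal_x_def)
  have lin: "linear (frechet_derivative f (at q))" "linear (frechet_derivative \<nu> (at q))"
    using linear_frechet_derivative smooth_on_differentiable smooth_f_D smooth_\<nu>_D q by blast+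
  have df: "frechet_derivative f (at q) (V q) = snd q *\<^sub>R ?x"
    using linear_plane_decomp[OF lin(1), of "V q"] f_v_eq[OF qB]
    by (simp add: V x dir_deriv_def algebra_simps)
  have d\<nu>: "frechet_derivative \<nu> (at q) (V q) = snd q *\<^sub>R ((- ?a) *\<^sub>R partial_u \<nu> q + ?b *\<^sub>R ?n1)"
    using linear_plane_decomp[OF lin(2), of "V q"] \<nu>_v_eq[OF qB]
    by (simp add: V dir_deriv_def algebra_simps)
  show ?thesis
  proof (cases "snd q = 0")
    case True
    then show ?thesis by (simp add: df d\<nu>)
  next
    case False
    let ?z = "(- ?a) *\<^sub>R partial_u \<nu> q + ?b *\<^sub>R ?n1 + \<kappa> q *\<^sub>R ?x"
    have sym: "partial_u f q \<bullet> ?n1 = - M_til f \<nu> q"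
      using weingarten_symmetric[OF qB] False unfolding f_v_eq[OF qB] \<nu>_v_eq[OF qB] by (simp add: M_til_def)
    have "\<nu> q \<bullet> ?h = 0"
      using normal[OF qB, of "(0, 1)"] f_v_eq[OF qB] False by (simp add: dir_deriv_def inner_commute)
    moreover have "\<nu> q \<bullet> ?n1 = 0"
      using \<nu>_orthogonal_derivative[OF qB, of "(0, 1)"] \<nu>_v_eq[OF qB] False by (simp add: dir_deriv_def)
    moreover have "\<nu> q \<bullet> partial_u f q = 0" "\<nu> q \<bullet> partial_u \<nu> q = 0"
      using normal[OF qB] \<nu>_orthogonal_derivative[OF qB] by (simp_all add: dir_deriv_def inner_commute)
    ultimately have "\<nu> q \<bullet> ?z = 0" by (simp add: x inner_add_right inner_diff_right)
    moreover have "partial_u f q \<bullet> ?z = 0"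
    proof -
      have "partial_u f q \<bullet> ?z = ?a * L_til f \<nu> q - ?b * M_til f \<nu> q + \<kappa> q * (- ?a * E_til f q + ?b * F_til f q)"
        unfolding x by (simp only: inner_add_right inner_scaleR_right sym)
          (simp add: L_til_def E_til_def F_til_def algebra_simps)
      also have "\<dots> = 0" by algebra
      finally show ?thesis .
    qed
    moreover have "?h \<bullet> ?z = 0"
    proof -
      have "?h \<bullet> ?z = ?a * M_til f \<nu> q - ?b * N1_til f \<nu> q + \<kappa> q * (- ?a * F_til f q + ?b * G_til f q)"
        unfolding x by (simp only: inner_add_right inner_scaleR_right)
          (simp add: M_til_def N1_til_def F_til_def G_til_def inner_commute[of ?h "partial_u f q"] algebra_simps)
      also have "\<dots> = ?a\<^sup>2 - ?b * (N1_til f \<nu> q - \<kappa> q * G_til f q)" by algebra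
      also have "\<dots> = 0"
        using principal_curv_quadratic[OF first_form_det_nonzero[OF q], of j] disc_pos[OF q] by simp
      finally show ?thesis .
    qed
    ultimately have "?z = 0" using orthogonal_to_frame[OF frame_det_nonzero[OF q]] by blast
    then have "(- ?a) *\<^sub>R partial_u \<nu> q + ?b *\<^sub>R ?n1 = - (\<kappa> q *\<^sub>R ?x)" by (rule eq_neg_iff_add_eq_0[THEN iffD2])
    then show ?thesis unfolding df d\<nu> by simp
  qed
qed

text \<open>The key identity: by Rodrigues' equation only the derivative of \<open>\<rho> = 1/\<kappa>\<close> survives in \<open>dC(V)\<close>.\<close>

lemma C_derivative_V:
  assumes "q \<in> D"
  shows "frechet_derivative C (at q) (V q) = - (V\<kappa> q / (\<kappa> q)\<^sup>2) *\<^sub>R \<nu> q"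
  using curv_nonzero[OF assms]
  by (simp add: C_derivative[OF assms] principal_direction[OF assms] V\<kappa>_def dir_deriv_def)

lemma linear_C: "q \<in> D \<Longrightarrow> linear (frechet_derivative C (at q))"
  using linear_frechet_derivative smooth_on_differentiable smooth_C by blast

text \<open>Because \<open>dC(V)\<close> is a multiple of \<open>\<nu>\<close>, the kernel can contain no direction other than \<open>V\<close>, as long as \<open>C\<^sub>u\<close> has a
  nonzero part \<open>T = f\<^sub>u + \<rho> \<nu>\<^sub>u\<close> orthogonal to \<open>\<nu>\<close>; indeed \<open>T \<bullet> f\<^sub>u\<close> is \<open>- \<rho> (L - \<kappa> E)\<close>.\<close>

lemma C_kernel:
  assumes q: "q \<in> D" and w: "frechet_derivative C (at q) w = 0"
  shows "w = (snd w / snd (V q)) *\<^sub>R V q" "w \<noteq> 0 \<Longrightarrow> V\<kappa> q = 0"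
proof -
  have qB: "q \<in> B" using in_B[OF q] .
  let ?A = "frechet_derivative C (at q)"
  \<comment> \<open>Writing \<open>w\<close> in the basis \<open>V, \<partial>\<^sub>u\<close>, up to the factor \<open>snd (V q)\<close>; the claim is that \<open>y\<close> vanishes.\<close>
  define y where "y = snd (V q) * fst w - snd w * fst (V q)"
  define T where "T = partial_u f q + (1 / \<kappa> q) *\<^sub>R partial_u \<nu> q"
  have v: "snd (V q) \<noteq> 0" using vector_v_nonzero[OF q] .
  have "snd (V q) *\<^sub>R w = snd w *\<^sub>R V q + y *\<^sub>R (1, 0)"
    by (simp add: y_def prod_eq_iff)
  then have "?A (snd (V q) *\<^sub>R w) = ?A (snd w *\<^sub>R V q + y *\<^sub>R (1, 0))" by (rule arg_cong)
  then have "snd w *\<^sub>R ?A (V q) + y *\<^sub>R ?A (1, 0) = 0"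
    by (simp only: linear_add[OF linear_C[OF q]] linear_cmul[OF linear_C[OF q]] w scaleR_zero_right)
  then have "y *\<^sub>R T = (y * frechet_derivative \<kappa> (at q) (1, 0) / (\<kappa> q)\<^sup>2 + snd w * V\<kappa> q / (\<kappa> q)\<^sup>2) *\<^sub>R \<nu> q" (is "_ = ?k *\<^sub>R _")
    unfolding C_derivative_V[OF q] C_derivative[OF q, of "(1, 0)"] T_def dir_deriv_def
    by (simp add: algebra_simps)
  then have "(y *\<^sub>R T) \<bullet> partial_u f q = (?k *\<^sub>R \<nu> q) \<bullet> partial_u f q" by (rule arg_cong)
  also have "\<dots> = 0" using normal[OF qB] by (simp add: dir_deriv_def inner_commute)
  finally have "y * (T \<bullet> partial_u f q) = 0" by simp
  moreover have "T \<bullet> partial_u f q = - snd (V q) / \<kappa> q"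
    using curv_nonzero[OF q]
    by (simp add: T_def principal_vector_def E_til_def L_til_def inner_add_left
        inner_commute[of "partial_u \<nu> q"] field_simps)
  ultimately have "y = 0" using v curv_nonzero[OF q] by simp
  then show "w = (snd w / snd (V q)) *\<^sub>R V q"
    using v by (simp add: y_def prod_eq_iff field_simps)
  then have "?A w = (snd w / snd (V q)) *\<^sub>R ?A (V q)"
    by (metis linear_cmul[OF linear_C[OF q]])
  moreover have "\<nu> q \<noteq> 0" using unit[OF qB] by auto
  ultimately have "snd w = 0 \<or> V\<kappa> q = 0"
    using w v curv_nonzero[OF q] by (simp add: C_derivative_V[OF q])
  moreover have "w = 0" if "snd w = 0"
    using \<open>w = (snd w / snd (V q)) *\<^sub>R V q\<close> that by simp
  ultimately show "w \<noteq> 0 \<Longrightarrow> V\<kappa> q = 0" by blast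
qed

lemma singular_C_iff:
  assumes q: "q \<in> D"
  shows "q \<in> singular_set C \<longleftrightarrow> V\<kappa> q = 0"
proof -
  have "V q \<noteq> 0" using vector_v_nonzero[OF q] by auto
  moreover have "frechet_derivative C (at q) (V q) = 0" if "V\<kappa> q = 0"
    using C_derivative_V[OF q] that by simp
  ultimately show ?thesis
    unfolding singular_set_iff[OF smooth_on_differentiable[OF smooth_C q]]
    using C_kernel(2)[OF q] by blast
qed

lemma lambda_fun_C:
  assumes q: "q \<in> D"
  shows "lambda_fun C e q = - det3 (partial_u C q) (\<nu> q) (e q) / ((\<kappa> q)\<^sup>2 * snd (V q)) * V\<kappa> q"
proof -
  have v: "snd (V q) \<noteq> 0" using vector_v_nonzero[OF q] .
  have "frechet_derivative C (at q) (V q) = fst (V q) *\<^sub>R partial_u C q + snd (V q) *\<^sub>R partial_v C q"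
    unfolding dir_deriv_def by (rule linear_plane_decomp[OF linear_C[OF q]])
  then have "snd (V q) *\<^sub>R partial_v C q = (- (V\<kappa> q / (\<kappa> q)\<^sup>2)) *\<^sub>R \<nu> q - fst (V q) *\<^sub>R partial_u C q"
    by (simp add: C_derivative_V[OF q] algebra_simps)
  then have "det3 (partial_u C q) (snd (V q) *\<^sub>R partial_v C q) (e q)
      = - (V\<kappa> q / (\<kappa> q)\<^sup>2) * det3 (partial_u C q) (\<nu> q) (e q)"
    by (simp only: det3_swap_arg)
  then show ?thesis
    using v curv_nonzero[OF q] by (simp add: lambda_fun_def det3_scaleR field_simps)
qed

text \<open>The function \<open>\<lambda>\<close> of \<open>C\<close> is a smooth multiple of \<open>V\<kappa>\<close>, and \<open>V\<kappa>\<close> vanishes at \<open>0\<close>, so \<open>d\<lambda>\<close> is a multiple of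
  \<open>d(V\<kappa>)\<close> there.\<close>

lemma nondegenerate_imp_regular:
  assumes "nondegenerate_singular_point C e 0"
  shows "V\<kappa> 0 = 0" "frechet_derivative V\<kappa> (at 0) \<noteq> (\<lambda>_. 0)"
proof -
  show V0: "V\<kappa> 0 = 0"
    using assms singular_C_iff[OF zero_in_D] by (simp add: nondegenerate_singular_point_def)
  let ?w = "\<lambda>q. - det3 (partial_u C q) (\<nu> q) (e q) / ((\<kappa> q)\<^sup>2 * snd (V q))"
  have "smooth_on ?w D"
    using curv_nonzero vector_v_nonzero
    by (intro smooth_on_divide smooth_on_minus smooth_on_det3 smooth_on_dir_deriv smooth_on_const smooth_C
        smooth_\<nu>_D smooth_e smooth_on_mult smooth_on_power2 smooth_on_snd smooth_\<kappa> smooth_V open_D) simp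
  from has_derivative_mult[OF smooth_on_has_derivative[OF this zero_in_D] smooth_on_has_derivative[OF smooth_V\<kappa> zero_in_D]]
  have "((\<lambda>q. ?w q * V\<kappa> q) has_derivative (\<lambda>y. ?w 0 * frechet_derivative V\<kappa> (at 0) y)) (at 0)"
    by (simp add: V0)
  then have "(lambda_fun C e has_derivative (\<lambda>y. ?w 0 * frechet_derivative V\<kappa> (at 0) y)) (at 0)"
    by (rule has_derivative_transform_within_open[OF _ open_D zero_in_D]) (simp add: lambda_fun_C)
  then have "frechet_derivative (lambda_fun C e) (at 0) = (\<lambda>y. ?w 0 * frechet_derivative V\<kappa> (at 0) y)"
    by (metis frechet_derivative_at)
  then show "frechet_derivative V\<kappa> (at 0) \<noteq> (\<lambda>_. 0)"
    using assms by (auto simp: nondegenerate_singular_point_def)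
qed

lemma V_0: "fst (V 0) = 0"
  by (simp add: principal_vector_def)

text \<open>At \<open>0\<close> the principal vector is a nonzero multiple of \<open>\<partial>\<^sub>v\<close>.\<close>

lemma ridge_iff:
  assumes "V\<kappa> 0 = 0"
  shows "ridge_at_least_second_order f \<nu> j 0 \<longleftrightarrow> partial_v V\<kappa> 0 = 0"
proof -
  have l: "linear (frechet_derivative V\<kappa> (at 0))"
    using linear_frechet_derivative smooth_on_differentiable[OF smooth_V\<kappa> zero_in_D] by blast
  have "dir_deriv V V\<kappa> 0 = snd (V 0) * partial_v V\<kappa> 0"
    using linear_plane_decomp[OF l, of "V 0"] by (simp add: dir_deriv_def V_0)
  then show ?thesis
    using assms vector_v_nonzero[OF zero_in_D]
    by (simp add: ridge_at_least_second_order_def numeral_2_eq_2 V\<kappa>_def)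
qed

text \<open>Along the singular curve \<open>V\<kappa> = 0\<close>, so \<open>d(V\<kappa>)\<close> kills its velocity. At a point of the second kind this velocity is
  a multiple of a null vector, hence vertical.\<close>

lemma second_kind_imp:
  assumes "second_kind_singular_point C e 0"
  shows "partial_v V\<kappa> 0 = 0"
proof -
  obtain \<epsilon> \<gamma> \<eta> where sc: "singular_curve C 0 \<epsilon> \<gamma>" and nf: "null_vector_field C \<epsilon> \<gamma> \<eta>"
    and dep: "\<not> lin_indep2 (vector_derivative \<gamma> (at 0)) (\<eta> 0)"
    using assms by (auto simp: second_kind_singular_point_def)
  let ?J = "{-\<epsilon><..<\<epsilon>}" and ?d = "vector_derivative \<gamma> (at 0)"
  have J: "0 \<in> ?J" "open ?J" and \<gamma>0: "\<gamma> 0 = 0" and sm: "smooth_on \<gamma> ?J" and d: "?d \<noteq> 0"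
    and sing: "\<And>t. t \<in> ?J \<Longrightarrow> \<gamma> t \<in> singular_set C"
    using sc by (auto simp: singular_curve_def)
  have \<eta>0: "\<eta> 0 \<noteq> 0" "frechet_derivative C (at 0) (\<eta> 0) = 0"
    using nf J(1) \<gamma>0 unfolding null_vector_field_def by (force, force)
  have \<gamma>': "(\<gamma> has_derivative (\<lambda>s. s *\<^sub>R ?d)) (at 0)"
    using smooth_on_differentiable[OF sm J(1)] vector_derivative_works[of \<gamma> "at 0"]
    by (simp add: has_vector_derivative_def)
  have "open (?J \<inter> \<gamma> -` D)"
    using continuous_open_preimage[OF smooth_on_continuous_on[OF sm] J(2) open_D] .
  moreover have "0 \<in> ?J \<inter> \<gamma> -` D" using J(1) \<gamma>0 zero_in_D by simp
  ultimately have zero: "((\<lambda>t. V\<kappa> (\<gamma> t)) has_derivative (\<lambda>_. 0)) (at 0)"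
  proof (rule has_derivative_transform_within_open[OF has_derivative_const[of "0::real"]])
    show "0 = V\<kappa> (\<gamma> t)" if "t \<in> ?J \<inter> \<gamma> -` D" for t
      using singular_C_iff[of "\<gamma> t"] sing[of t] that by simp
  qed
  have dV: "(V\<kappa> has_derivative frechet_derivative V\<kappa> (at 0)) (at (\<gamma> 0))"
    using smooth_on_has_derivative[OF smooth_V\<kappa> zero_in_D] by (simp add: \<gamma>0)
  have "(\<lambda>s. frechet_derivative V\<kappa> (at 0) (s *\<^sub>R ?d)) = (\<lambda>_. 0)"
    by (rule has_derivative_unique[OF has_derivative_compose[OF \<gamma>' dV] zero])
  then have "frechet_derivative V\<kappa> (at 0) (1 *\<^sub>R ?d) = 0" by (rule fun_cong)
  then have 0: "fst ?d * partial_u V\<kappa> 0 + snd ?d * partial_v V\<kappa> 0 = 0"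
    using linear_plane_decomp[OF has_derivative_linear[OF dV], of ?d] by (simp add: dir_deriv_def)
  obtain c where c: "?d = c *\<^sub>R \<eta> 0" using not_lin_indep2D[OF dep \<eta>0(1)] .
  have "fst (\<eta> 0) = (snd (\<eta> 0) / snd (V 0)) * fst (V 0)"
    using arg_cong[OF C_kernel(1)[OF zero_in_D \<eta>0(2)], of fst] by simp
  then have "fst ?d = 0" by (simp add: c V_0)
  then show ?thesis using 0 d by (simp add: prod_eq_iff)
qed

text \<open>Nondegeneracy leaves \<open>\<partial>\<^sub>u(V\<kappa>) \<noteq> 0\<close> at \<open>0\<close>, so the singular set is a graph \<open>u = c(v)\<close> with
  \<open>c'(0) = 0\<close>. It serves as the singular curve, with \<open>V\<close> itself as null vector field; both are vertical at \<open>0\<close>.\<close>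

lemma imp_second_kind:
  assumes nd: "nondegenerate_singular_point C e 0" and "partial_v V\<kappa> 0 = 0"
  shows "second_kind_singular_point C e 0"
proof -
  note reg = nondegenerate_imp_regular[OF nd]
  have "partial_u V\<kappa> 0 \<noteq> 0"
  proof
    assume "partial_u V\<kappa> 0 = 0"
    then have "frechet_derivative V\<kappa> (at 0) w = 0" for w
      using linear_plane_decomp[OF has_derivative_linear[OF smooth_on_has_derivative[OF smooth_V\<kappa> zero_in_D]], of w]
        assms(2) by (simp add: dir_deriv_def)
    then show False using reg(2) by auto
  qed
  from smooth_implicit_function[OF open_D smooth_V\<kappa> zero_in_D reg(1) this]
  obtain \<epsilon> W c where "0 < \<epsilon>" and W: "open W" "0 \<in> W" "W \<subseteq> D" and c: "smooth_on c {-\<epsilon><..<\<epsilon>}" "c 0 = 0"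
    "(c has_real_derivative - partial_v V\<kappa> 0 / partial_u V\<kappa> 0) (at 0)"
    and zeros: "{q \<in> W. V\<kappa> q = 0} = (\<lambda>t. (c t, t)) ` {-\<epsilon><..<\<epsilon>}"
    .
  let ?J = "{-\<epsilon><..<\<epsilon>}"
  define \<gamma> where "\<gamma> t = (c t, t)" for t :: real
  have \<gamma>_deriv: "(\<gamma> has_vector_derivative (c', 1)) (at t)" if "(c has_real_derivative c') (at t)" for c' t
    unfolding \<gamma>_def
    using that by (intro has_vector_derivative_Pair has_vector_derivative_id)
      (simp add: has_real_derivative_iff_has_vector_derivative)
  have \<gamma>'0: "vector_derivative \<gamma> (at 0) = (0, 1)"
    using \<gamma>_deriv[OF c(3)] assms(2) by (simp add: vector_derivative_at)
  have \<gamma>': "vector_derivative \<gamma> (at t) \<noteq> 0" if t: "t \<in> ?J" for t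
  proof -
    obtain c' where "(c has_real_derivative c') (at t)"
      using smooth_on_differentiable[OF c(1) t] real_differentiable_def by blast
    then show ?thesis using vector_derivative_at[OF \<gamma>_deriv] by (metis one_neq_zero snd_conv snd_zero)
  qed
  have zeros': "singular_set C \<inter> W = \<gamma> ` ?J"
    using zeros singular_C_iff W(3) unfolding \<gamma>_def by blast
  have "singular_curve C 0 \<epsilon> \<gamma>"
    unfolding singular_curve_def
  proof (intro conjI)
    show "smooth_on \<gamma> ?J"
      unfolding \<gamma>_def[abs_def] by (intro smooth_on_Pair c(1) smooth_on_ident) auto
    show "inj_on \<gamma> ?J" by (auto simp: inj_on_def \<gamma>_def)
    show "\<exists>W. open W \<and> 0 \<in> W \<and> singular_set C \<inter> W = \<gamma> ` ?J" using W zeros' by blast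
  qed (use \<open>0 < \<epsilon>\<close> c(2) \<gamma>' in \<open>auto simp: \<gamma>_def zero_prod_def\<close>)
  moreover have "null_vector_field C \<epsilon> \<gamma> V"
    unfolding null_vector_field_def
  proof (intro conjI exI[of _ D] ballI)
    show "\<gamma> ` ?J \<subseteq> D" using zeros' W(3) by blast
    show "V q \<noteq> 0" if "q \<in> D" for q using vector_v_nonzero[OF that] by auto
    show "frechet_derivative C (at (\<gamma> t)) (V (\<gamma> t)) = 0" if "t \<in> ?J" for t
    proof -
      have "\<gamma> t \<in> {q \<in> W. V\<kappa> q = 0}" unfolding zeros using that by (auto simp: \<gamma>_def)
      then show ?thesis using C_derivative_V[of "\<gamma> t"] W(3) by auto
    qed
  qed (rule open_D smooth_V)+
  moreover have "\<not> lin_indep2 (vector_derivative \<gamma> (at 0)) (V 0)"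
  proof -
    have "(0, 1) = inverse (snd (V 0)) *\<^sub>R V 0"
      using V_0 vector_v_nonzero[OF zero_in_D] by (simp add: prod_eq_iff)
    then show ?thesis unfolding \<gamma>'0 by (metis lin_indep2_scaleR)
  qed
  ultimately show ?thesis using nd unfolding second_kind_singular_point_def by blast
qed

lemma ridge_iff_second_kind:
  assumes "nondegenerate_singular_point C e 0"
  shows "ridge_at_least_second_order f \<nu> j 0 \<longleftrightarrow> second_kind_singular_point C e 0"
  using ridge_iff[OF nondegenerate_imp_regular(1)[OF assms]] second_kind_imp imp_second_kind[OF assms] by blast

end


section \<open>Passage to adapted coordinates\<close>

lemma local_inverse_derivative:
  fixes \<phi> :: "'a::euclidean_space \<Rightarrow> 'a"
  assumes "homeomorphism U V \<phi> \<theta>" "open U" "open V" "smooth_on \<phi> U" "smooth_on \<theta> V" "q \<in> U"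
  shows "frechet_derivative \<theta> (at (\<phi> q)) (frechet_derivative \<phi> (at q) w) = w"
    and "frechet_derivative \<phi> (at q) (frechet_derivative \<theta> (at (\<phi> q)) w) = w"
proof -
  have inv: "\<And>x. x \<in> U \<Longrightarrow> \<theta> (\<phi> x) = x" "\<And>y. y \<in> V \<Longrightarrow> \<phi> (\<theta> y) = y" "\<phi> q \<in> V"
    using assms(1,6) by (auto simp: homeomorphism_def)
  have d: "(\<phi> has_derivative frechet_derivative \<phi> (at q)) (at q)"
    "(\<theta> has_derivative frechet_derivative \<theta> (at (\<phi> q))) (at (\<phi> q))"
    using smooth_on_has_derivative assms inv(3) by blast+
  have "((\<lambda>x. \<theta> (\<phi> x)) has_derivative (\<lambda>w. w)) (at q)"
    by (rule has_derivative_transform_within_open[OF has_derivative_ident assms(2,6)]) (simp add: inv)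
  from has_derivative_unique[OF has_derivative_compose[OF d] this]
  show "frechet_derivative \<theta> (at (\<phi> q)) (frechet_derivative \<phi> (at q) w) = w"
    by (rule fun_cong)
  have d': "(\<phi> has_derivative frechet_derivative \<phi> (at q)) (at (\<theta> (\<phi> q)))"
    using d(1) inv(1)[OF assms(6)] by simp
  have "((\<lambda>x. \<phi> (\<theta> x)) has_derivative (\<lambda>w. w)) (at (\<phi> q))"
    by (rule has_derivative_transform_within_open[OF has_derivative_ident assms(3) inv(3)]) (simp add: inv)
  from has_derivative_unique[OF has_derivative_compose[OF d(2) d'] this]
  show "frechet_derivative \<phi> (at q) (frechet_derivative \<theta> (at (\<phi> q)) w) = w"
    by (rule fun_cong)
qed

lemma frechet_derivative_chain:
  assumes "(h has_derivative h') (at q)" "f differentiable at (h q)"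
  shows "frechet_derivative (f \<circ> h) (at q) w = frechet_derivative f (at (h q)) (h' w)"
proof -
  have "(f \<circ> h has_derivative (\<lambda>w. frechet_derivative f (at (h q)) (h' w))) (at q)"
    using has_derivative_compose[OF assms(1) assms(2)[unfolded frechet_derivative_works]]
    by (simp add: o_def)
  from frechet_derivative_at[OF this, symmetric] show ?thesis by simp
qed

text \<open>The condition \<open>\<psi> = 0\<close> is stated for some singular curve \<open>\<gamma>\<close> and null vector field \<open>\<eta>\<close> of \<open>f\<close>. In the chart
  the velocity of \<open>\<gamma>\<close> is a nonzero multiple of \<open>\<partial>\<^sub>u\<close> and \<open>\<eta>\<close> a nonzero multiple of \<open>\<partial>\<^sub>v\<close>, so the condition reads
  \<open>det(f\<^sub>u, \<nu>, \<nu>\<^sub>v) = 0\<close>. Since \<open>\<nu>\<^sub>v\<close> is orthogonal to \<open>\<nu>\<close> and, on the axis, to \<open>f\<^sub>u\<close>, it vanishes.\<close>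

lemma pure_frontal_axis:
  assumes hom: "homeomorphism U V \<phi> \<theta>" and UV: "open U" "open V" and sm: "smooth_on \<phi> U" "smooth_on \<theta> V"
    and frontal: "frontal_chart f \<nu> N"
    and chart: "frontal_chart (f \<circ> \<phi>) (\<nu> \<circ> \<phi>) B" "B \<subseteq> U" "\<phi> ` B \<subseteq> N"
    and axis: "singular_set (f \<circ> \<phi>) \<inter> B = {q \<in> B. snd q = 0}"
    and q: "q \<in> B" "snd q = 0"
    and f_v: "partial_v (f \<circ> \<phi>) q = 0" and f_u: "norm (partial_u (f \<circ> \<phi>) q) = 1"
    and curve: "singular_curve f 0 \<epsilon> \<gamma>" and null: "null_vector_field f \<epsilon> \<gamma> \<eta>"
    and \<psi>: "\<forall>t\<in>{-\<epsilon><..<\<epsilon>}. psi_fun f \<nu> \<gamma> \<eta> t = 0"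
    and \<phi>_q: "\<phi> q \<in> \<gamma> ` {-\<epsilon><..<\<epsilon>}"
  shows "partial_v (\<nu> \<circ> \<phi>) q = 0"
proof -
  interpret N: frontal_chart f \<nu> N by fact
  interpret B: frontal_chart "f \<circ> \<phi>" "\<nu> \<circ> \<phi>" B by fact
  let ?J = "{-\<epsilon><..<\<epsilon>}"
  obtain t where t: "t \<in> ?J" and p: "\<phi> q = \<gamma> t" using \<phi>_q by blast
  have sm\<gamma>: "smooth_on \<gamma> ?J" and d: "vector_derivative \<gamma> (at t) \<noteq> 0"
    and sing: "\<And>s. s \<in> ?J \<Longrightarrow> \<gamma> s \<in> singular_set f"
    using curve t by (auto simp: singular_curve_def)
  define d where "d = vector_derivative \<gamma> (at t)"
  have \<gamma>': "(\<gamma> has_derivative (\<lambda>s. s *\<^sub>R d)) (at t)"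
    using smooth_on_differentiable[OF sm\<gamma> t] vector_derivative_works[of \<gamma> "at t"]
    by (simp add: has_vector_derivative_def d_def)
  let ?g = "f \<circ> \<phi>" and ?n = "\<nu> \<circ> \<phi>"
  have \<theta>\<phi>: "\<And>x. x \<in> U \<Longrightarrow> \<theta> (\<phi> x) = x" and \<phi>\<theta>: "\<And>y. y \<in> V \<Longrightarrow> \<phi> (\<theta> y) = y" and \<phi>V: "\<And>x. x \<in> U \<Longrightarrow> \<phi> x \<in> V"
    using hom by (auto simp: homeomorphism_def)
  have chain: "frechet_derivative ?g (at x) w = frechet_derivative f (at (\<phi> x)) (frechet_derivative \<phi> (at x) w)"
    "frechet_derivative ?n (at x) w = frechet_derivative \<nu> (at (\<phi> x)) (frechet_derivative \<phi> (at x) w)"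
    if "x \<in> B" for x w
  proof -
    have "x \<in> U" "\<phi> x \<in> N" using that chart(2,3) by auto
    then show "frechet_derivative ?g (at x) w = frechet_derivative f (at (\<phi> x)) (frechet_derivative \<phi> (at x) w)"
      "frechet_derivative ?n (at x) w = frechet_derivative \<nu> (at (\<phi> x)) (frechet_derivative \<phi> (at x) w)"
      using frechet_derivative_chain[OF smooth_on_has_derivative[OF sm(1)]]
        smooth_on_differentiable[OF N.smooth_f] smooth_on_differentiable[OF N.smooth_\<nu>] by blast+
  qed
  have lift: "frechet_derivative f (at (\<phi> x)) w = frechet_derivative ?g (at x) (frechet_derivative \<theta> (at (\<phi> x)) w)"
    "frechet_derivative \<nu> (at (\<phi> x)) w = frechet_derivative ?n (at x) (frechet_derivative \<theta> (at (\<phi> x)) w)"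
    "w \<noteq> 0 \<Longrightarrow> frechet_derivative \<theta> (at (\<phi> x)) w \<noteq> 0"
    if "x \<in> B" for x w
  proof -
    have xU: "x \<in> U" using that chart(2) by auto
    note inv = local_inverse_derivative(2)[OF hom UV sm xU, of w]
    show "frechet_derivative f (at (\<phi> x)) w = frechet_derivative ?g (at x) (frechet_derivative \<theta> (at (\<phi> x)) w)"
      "frechet_derivative \<nu> (at (\<phi> x)) w = frechet_derivative ?n (at x) (frechet_derivative \<theta> (at (\<phi> x)) w)"
      by (simp_all only: chain[OF that] inv)
    have "linear (frechet_derivative \<phi> (at x))"
      using linear_frechet_derivative smooth_on_differentiable[OF sm(1) xU] by blast
    then show "w \<noteq> 0 \<Longrightarrow> frechet_derivative \<theta> (at (\<phi> x)) w \<noteq> 0"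
      using inv linear_0 by metis
  qed
  have lin_g: "linear (frechet_derivative ?g (at q))" and lin_n: "linear (frechet_derivative ?n (at q))"
    using linear_frechet_derivative smooth_on_differentiable B.smooth_f B.smooth_\<nu> q(1) by blast+
  have qU: "q \<in> U" using q chart(2) by auto
  define J' where "J' = ?J \<inter> \<gamma> -` (V \<inter> \<theta> -` B)"
  have "open J'"
    unfolding J'_def
    by (intro continuous_open_preimage[OF smooth_on_continuous_on[OF sm\<gamma>]]
        continuous_open_preimage[OF smooth_on_continuous_on[OF sm(2)]] UV B.open_B) simp
  have tJ': "t \<in> J'" using t q(1) qU \<phi>V \<theta>\<phi> p[symmetric] by (simp add: J'_def)
  \<comment> \<open>Points of \<open>\<gamma>\<close> are singular for \<open>f\<close>, hence lie on the axis of the chart; so the second coordinate of \<open>\<theta> \<circ> \<gamma>\<close> is constant near \<open>t\<close>.\<close>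
  have on_axis: "snd (\<theta> (\<gamma> s)) = 0" if "s \<in> J'" for s
  proof -
    let ?x = "\<theta> (\<gamma> s)"
    have s: "s \<in> ?J" "\<gamma> s \<in> V" "?x \<in> B" using that by (auto simp: J'_def)
    have \<phi>x: "\<phi> ?x = \<gamma> s" using \<phi>\<theta> s(2) by simp
    have "\<gamma> s \<in> N" using s(3) chart(3) \<phi>x by (metis image_subset_iff)
    then obtain w where w: "w \<noteq> 0" "frechet_derivative f (at (\<phi> ?x)) w = 0"
      using singular_set_iff[OF smooth_on_differentiable[OF N.smooth_f]] sing[OF s(1)] \<phi>x by metis
    then have "?x \<in> singular_set ?g"
      using singular_set_iff[OF smooth_on_differentiable[OF B.smooth_f s(3)]] lift(1,3)[OF s(3)] by metis
    then show ?thesis using axis s(3) by blast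
  qed
  let ?c' = "frechet_derivative \<theta> (at (\<phi> q)) d"
  have d\<theta>: "(\<theta> has_derivative frechet_derivative \<theta> (at (\<phi> q))) (at (\<gamma> t))"
    using smooth_on_has_derivative[OF sm(2) \<phi>V[OF qU]] p by simp
  have "((\<lambda>s. snd (\<theta> (\<gamma> s))) has_derivative (\<lambda>s. snd (frechet_derivative \<theta> (at (\<phi> q)) (s *\<^sub>R d)))) (at t)"
    by (intro has_derivative_snd has_derivative_compose[OF \<gamma>' d\<theta>])
  moreover have "((\<lambda>s. snd (\<theta> (\<gamma> s))) has_derivative (\<lambda>_. 0)) (at t)"
    by (rule has_derivative_transform_within_open[OF has_derivative_const[of "0::real"] \<open>open J'\<close> tJ'])
      (simp add: on_axis)
  ultimately have "(\<lambda>s. snd (frechet_derivative \<theta> (at (\<phi> q)) (s *\<^sub>R d))) = (\<lambda>_. 0)"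
    by (rule has_derivative_unique)
  then have "snd (frechet_derivative \<theta> (at (\<phi> q)) (1 *\<^sub>R d)) = 0" by (rule fun_cong)
  then have c'2: "snd ?c' = 0" by simp
  have c'1: "fst ?c' \<noteq> 0"
    using lift(3)[OF q(1), of d] \<open>vector_derivative \<gamma> (at t) \<noteq> 0\<close> c'2 by (auto simp: d_def prod_eq_iff)
  have "frechet_derivative f (at (\<phi> q)) d = fst ?c' *\<^sub>R partial_u ?g q"
    using linear_plane_decomp[OF lin_g, of ?c'] lift(1)[OF q(1), of d] c'2 by (simp add: dir_deriv_def)
  moreover have "vector_derivative (f \<circ> \<gamma>) (at t) = frechet_derivative f (at (\<phi> q)) d"
  proof -
    have "\<phi> q \<in> N" using q(1) chart(3) by blast
    then have df: "(f has_derivative frechet_derivative f (at (\<phi> q))) (at (\<gamma> t))"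
      using smooth_on_has_derivative[OF N.smooth_f] p by simp
    have "(\<lambda>s. frechet_derivative f (at (\<phi> q)) (s *\<^sub>R d)) = (\<lambda>s. s *\<^sub>R frechet_derivative f (at (\<phi> q)) d)"
      using linear_cmul[OF has_derivative_linear[OF df]] by (rule ext)
    then have "(f \<circ> \<gamma> has_vector_derivative frechet_derivative f (at (\<phi> q)) d) (at t)"
      using has_derivative_compose[OF \<gamma>' df] by (simp add: has_vector_derivative_def o_def)
    then show ?thesis by (rule vector_derivative_at)
  qed
  ultimately have f\<gamma>: "vector_derivative (f \<circ> \<gamma>) (at t) = fst ?c' *\<^sub>R partial_u ?g q" by simp
  let ?e = "frechet_derivative \<theta> (at (\<phi> q)) (\<eta> (\<gamma> t))"
  have \<eta>: "\<eta> (\<gamma> t) \<noteq> 0" "frechet_derivative f (at (\<phi> q)) (\<eta> (\<gamma> t)) = 0"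
    using null t p unfolding null_vector_field_def image_subset_iff by auto
  have "fst ?e *\<^sub>R partial_u ?g q = 0"
    using linear_plane_decomp[OF lin_g, of ?e] lift(1)[OF q(1), of "\<eta> (\<gamma> t)"] \<eta>(2) f_v by (simp add: dir_deriv_def)
  then have e1: "fst ?e = 0" using f_u by auto
  have e2: "snd ?e \<noteq> 0" using lift(3)[OF q(1) \<eta>(1)] e1 by (auto simp: prod_eq_iff)
  have \<nu>\<eta>: "dir_deriv \<eta> \<nu> (\<gamma> t) = snd ?e *\<^sub>R partial_v ?n q"
    using linear_plane_decomp[OF lin_n, of ?e] lift(2)[OF q(1), of "\<eta> (\<gamma> t)"] e1 p by (simp add: dir_deriv_def)
  have "psi_fun f \<nu> \<gamma> \<eta> t = snd ?e * (fst ?c' * det3 (partial_u ?g q) (?n q) (partial_v ?n q))"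
    unfolding psi_fun_def f\<gamma> \<nu>\<eta> det3_scaleR by (simp add: p)
  then have "det3 (partial_u ?g q) (?n q) (partial_v ?n q) = 0"
    using bspec[OF \<psi> t] c'1 e2 by simp
  moreover have "partial_v ?n q \<bullet> partial_u ?g q = 0"
    using B.weingarten_symmetric[OF q(1)] f_v by (simp add: inner_commute)
  moreover have "partial_v ?n q \<bullet> ?n q = 0" "partial_u ?g q \<bullet> ?n q = 0"
    using B.\<nu>_orthogonal_derivative[OF q(1)] B.normal[OF q(1)] by (simp_all add: dir_deriv_def inner_commute)
  ultimately show ?thesis
    using det3_eq_0_orthonormal[OF f_u B.unit[OF q(1)]] by blast
qed

lemma frontal_chart_compose:
  assumes "frontal_chart f \<nu> N" "open B" "smooth_on \<phi> B" "\<phi> ` B \<subseteq> N"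
  shows "frontal_chart (f \<circ> \<phi>) (\<nu> \<circ> \<phi>) B"
proof -
  interpret N: frontal_chart f \<nu> N by fact
  show ?thesis
  proof
    show "smooth_on (f \<circ> \<phi>) B" "smooth_on (\<nu> \<circ> \<phi>) B"
      using smooth_on_compose[OF assms(2,3) _ assms(4)] N.smooth_f N.smooth_\<nu> by (simp_all add: o_def)
    fix q assume q: "q \<in> B"
    then have "\<phi> q \<in> N" using assms(4) by blast
    then show "norm ((\<nu> \<circ> \<phi>) q) = 1" "frechet_derivative (f \<circ> \<phi>) (at q) X \<bullet> (\<nu> \<circ> \<phi>) q = 0" for X
      using N.unit N.normal frechet_derivative_chain[OF smooth_on_has_derivative[OF assms(3) q]
          smooth_on_differentiable[OF N.smooth_f]] by simp_all
  qed (rule assms(2))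
qed

lemma adapted_chart_exists:
  assumes "frontal_at f \<nu> 0" "pure_frontal_singular_point f \<nu> 0" "adapted_coordinates f \<nu> \<phi>"
  obtains r where "adapted_chart (f \<circ> \<phi>) (\<nu> \<circ> \<phi>) (ball 0 r) r"
proof -
  obtain N where N: "frontal_chart f \<nu> N" "0 \<in> N"
    using assms(1) unfolding frontal_at_def frontal_chart_def by blast
  obtain U V \<theta> where \<phi>0: "\<phi> 0 = 0" and U: "open U" "0 \<in> U" "open V" and hom: "homeomorphism U V \<phi> \<theta>"
    and sm: "smooth_on \<phi> U" "smooth_on \<theta> V"
    using assms(3) unfolding adapted_coordinates_def local_diffeo_at_0_def by blast
  obtain A where A: "open A" "0 \<in> A" and axis: "singular_set (f \<circ> \<phi>) \<inter> A = {q \<in> A. snd q = 0}"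
    and frame: "\<And>q. q \<in> A \<Longrightarrow> snd q = 0 \<Longrightarrow> partial_v (f \<circ> \<phi>) q = 0 \<and>
      orthonormal3 (partial_u (f \<circ> \<phi>) q) (partial_v (partial_v (f \<circ> \<phi>)) q) (\<nu> (\<phi> q))"
    using assms(3) unfolding adapted_coordinates_def by blast
  obtain \<epsilon> \<gamma> \<eta> where curve: "singular_curve f 0 \<epsilon> \<gamma>" and null: "null_vector_field f \<epsilon> \<gamma> \<eta>"
    and \<psi>: "\<forall>t\<in>{-\<epsilon><..<\<epsilon>}. psi_fun f \<nu> \<gamma> \<eta> t = 0"
    using assms(2) unfolding pure_frontal_singular_point_def by blast
  obtain W where W: "open W" "0 \<in> W" "singular_set f \<inter> W = \<gamma> ` {-\<epsilon><..<\<epsilon>}"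
    using curve unfolding singular_curve_def by blast
  interpret N: frontal_chart f \<nu> N by fact
  define Q where "Q = A \<inter> (U \<inter> \<phi> -` (N \<inter> W))"
  have "open Q"
    unfolding Q_def
    by (intro open_Int A(1) continuous_open_preimage[OF smooth_on_continuous_on[OF sm(1)]] U(1) N.open_B W(1))
  moreover have "0 \<in> Q" using A(2) U(2) N(2) W(2) \<phi>0 by (simp add: Q_def)
  ultimately obtain r where r: "0 < r" "ball 0 r \<subseteq> Q" using open_contains_ball by blast
  let ?B = "ball (0 :: plane) r"
  have B: "?B \<subseteq> A" "?B \<subseteq> U" "\<phi> ` ?B \<subseteq> N" "\<phi> ` ?B \<subseteq> W" using r(2) by (auto simp: Q_def)
  have chart: "frontal_chart (f \<circ> \<phi>) (\<nu> \<circ> \<phi>) ?B"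
    by (rule frontal_chart_compose[OF N(1) open_ball smooth_on_subset[OF sm(1) B(2)] B(3)])
  then interpret B: frontal_chart "f \<circ> \<phi>" "\<nu> \<circ> \<phi>" ?B .
  have axis': "singular_set (f \<circ> \<phi>) \<inter> ?B = {q \<in> ?B. snd q = 0}" using axis B(1) by blast
  have f_v: "partial_v (f \<circ> \<phi>) q = 0" "norm (partial_u (f \<circ> \<phi>) q) = 1" if "q \<in> ?B" "snd q = 0" for q
    using frame[of q] that B(1) by (auto simp: orthonormal3_def)
  have "adapted_chart (f \<circ> \<phi>) (\<nu> \<circ> \<phi>) ?B r"
  proof
    show "orthonormal3 (partial_u (f \<circ> \<phi>) 0) (partial_v (partial_v (f \<circ> \<phi>)) 0) ((\<nu> \<circ> \<phi>) 0)"
      using frame[OF A(2)] by simp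
    fix q assume q: "q \<in> ?B" "snd q = 0"
    show "partial_v (f \<circ> \<phi>) q = 0" using f_v(1) q .
    have "\<phi> q \<in> N" "\<phi> q \<in> W" using q(1) B by blast+
    have qU: "q \<in> U" using q(1) B(2) by blast
    have "frechet_derivative f (at (\<phi> q)) (frechet_derivative \<phi> (at q) (0, 1)) = 0"
      using f_v(1)[OF q] frechet_derivative_chain[OF smooth_on_has_derivative[OF sm(1) qU]
          smooth_on_differentiable[OF N.smooth_f \<open>\<phi> q \<in> N\<close>]] by (simp add: dir_deriv_def)
    moreover have "frechet_derivative \<phi> (at q) (0, 1) \<noteq> 0"
    proof
      assume "frechet_derivative \<phi> (at q) (0, 1) = 0"
      then have "frechet_derivative \<theta> (at (\<phi> q)) 0 = (0, 1)"
        using local_inverse_derivative(1)[OF hom U(1,3) sm qU, of "(0, 1)"] by simp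
      moreover have "linear (frechet_derivative \<theta> (at (\<phi> q)))"
        using linear_frechet_derivative smooth_on_differentiable[OF sm(2)] qU hom
        unfolding homeomorphism_def by blast
      ultimately have "(0, 1) = (0 :: plane)" using linear_0 by metis
      then show False by (simp add: prod_eq_iff)
    qed
    ultimately have "\<phi> q \<in> singular_set f"
      using singular_set_iff[OF smooth_on_differentiable[OF N.smooth_f \<open>\<phi> q \<in> N\<close>]] by blast
    then have "\<phi> q \<in> \<gamma> ` {-\<epsilon><..<\<epsilon>}" using W(3) \<open>\<phi> q \<in> W\<close> by blast
    then show "partial_v (\<nu> \<circ> \<phi>) q = 0"
      using pure_frontal_axis[OF hom U(1,3) sm N(1) chart B(2,3) axis' q f_v[OF q] curve null \<psi>] by blast
  qed (rule refl r(1))+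
  then show ?thesis by (rule that)
qed


theorem proposition4p9:
  fixes f \<nu> f\<^sub>a \<nu>\<^sub>a :: "plane \<Rightarrow> space" and \<phi> :: "plane \<Rightarrow> plane" and j :: nat
  assumes "f 0 = 0"
    and "frontal_at f \<nu> 0"
    and "pure_frontal_singular_point f \<nu> 0"
    and "adapted_coordinates f \<nu> \<phi>"
    and "f\<^sub>a = f \<circ> \<phi>" and "\<nu>\<^sub>a = \<nu> \<circ> \<phi>"
    and "cuspidal_torsion f\<^sub>a \<nu>\<^sub>a 0 \<noteq> 0"
    and "\<forall>\<^sub>F q in nhds 0. principal_curv f\<^sub>a \<nu>\<^sub>a 1 q \<noteq> 0 \<and> principal_curv f\<^sub>a \<nu>\<^sub>a 2 q \<noteq> 0"
    and "j \<in> {1, 2}"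
    and "nondegenerate_singular_point (focal_surface f\<^sub>a \<nu>\<^sub>a j) (focal_normal f\<^sub>a \<nu>\<^sub>a j) 0"
  shows "ridge_at_least_second_order f\<^sub>a \<nu>\<^sub>a j 0 \<longleftrightarrow>
         second_kind_singular_point (focal_surface f\<^sub>a \<nu>\<^sub>a j) (focal_normal f\<^sub>a \<nu>\<^sub>a j) 0"
proof -
  obtain r where chart: "adapted_chart f\<^sub>a \<nu>\<^sub>a (ball 0 r) r"
    using adapted_chart_exists[OF assms(2-4)] assms(5,6) by blast
  interpret adapted_chart f\<^sub>a \<nu>\<^sub>a "ball 0 r" r by (rule chart)
  have "M_til f\<^sub>a \<nu>\<^sub>a 0 \<noteq> 0"
    using assms(7) by (simp add: cuspidal_torsion_def zero_prod_def)
  moreover have "\<forall>\<^sub>F q in nhds 0. principal_curv f\<^sub>a \<nu>\<^sub>a j q \<noteq> 0"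
    using assms(8) by eventually_elim (use assms(9) in auto)
  ultimately obtain D where D: "open D" "0 \<in> D" "D \<subseteq> ball 0 r"
    "\<And>q. q \<in> D \<Longrightarrow> first_form_det q \<noteq> 0 \<and> disc q > 0 \<and> principal_curv f\<^sub>a \<nu>\<^sub>a j q \<noteq> 0 \<and>
      snd (principal_vector f\<^sub>a \<nu>\<^sub>a j q) \<noteq> 0 \<and> focal_x f\<^sub>a \<nu>\<^sub>a j q \<noteq> 0 \<and>
      det3 (partial_u f\<^sub>a q) (h_fun f\<^sub>a q) (\<nu>\<^sub>a q) \<noteq> 0"
    using regular_domain_exists by blast
  interpret focal_chart f\<^sub>a \<nu>\<^sub>a "ball 0 r" r j D
    by unfold_locales (use D in blast)+
  show ?thesis by (rule ridge_iff_second_kind[OF assms(10)])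
qed

end
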